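(* Let $\Gamma=(G,\sigma)$ be a connected signed graph containing at least one cycle, with girth $g$, and let $C_g^\sigma$ be a shortest cycle of $\Gamma$. Then $i_+(\Gamma)\ge\lceil g/2\rceil-1$. Moreover, equality holds if and only if one of the following holds: (1) $\Gamma=C_g^\sigma$ is a cycle, and either $C_g^\sigma$ is balanced with $g\equiv 0,3\pmod 4$, or $C_g^\sigma$ is unbalanced with $g\equiv 1,2\pmod 4$; (2) $\Gamma$ is switching equivalent to $(K_{n_1,n_2,\dots,n_l},+)$ for some $l\ge 2$ (the complete multipartite graph with all edges positive).
   Context: A signed graph $\Gamma=(G,\sigma)$ is a simple graph $G$ with a sign function $\sigma:E(G)\to\{+,-\}$; $(G,+)$ denotes all edges positive. Its adjacency matrix $A(\Gamma)$ has $(u,v)$-entry $\sigma(uv)$ if $uv\in E(G)$ and $0$ otherwise; $i_+(\Gamma)$ is the number of positive eigenvalues of $A(\Gamma)$. A cycle is balanced if the product of its edge signs is $+$, unbalanced otherwise. Switching by $\theta:V\to\{+,-\}$ replaces $\sigma(xy)$ by $\theta(x)\sigma(xy)\theta(y)$; switching equivalent signed graphs are related by a switching. The girth is the length of a shortest cycle. $K_{n_1,\dots,n_l}$ is the complete multipartite graph with parts of sizes $n_1,\dots,n_l$. *)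

theory Defs
  imports "Jordan_Normal_Form.Char_Poly"
begin

definition signed_graph :: "nat \<Rightarrow> (nat \<Rightarrow> nat \<Rightarrow> bool) \<Rightarrow> (nat \<Rightarrow> nat \<Rightarrow> real) \<Rightarrow> bool" where
  "signed_graph n E sg \<longleftrightarrow>
     (\<forall>i j. E i j \<longrightarrow> i < n \<and> j < n) \<and>
     (\<forall>i j. E i j \<longrightarrow> E j i) \<and>
     (\<forall>i. \<not> E i i) \<and>
     (\<forall>i j. E i j \<longrightarrow> sg i j = sg j i \<and> (sg i j = 1 \<or> sg i j = -1))"

definition adj_matrix :: "nat \<Rightarrow> (nat \<Rightarrow> nat \<Rightarrow> bool) \<Rightarrow> (nat \<Rightarrow> nat \<Rightarrow> real) \<Rightarrow> real mat" where
  "adj_matrix n E sg = mat n n (\<lambda>(i, j). if E i j then sg i j else 0)"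

definition pos_inertia :: "real mat \<Rightarrow> nat" where
  "pos_inertia A = (\<Sum>x\<in>{x. eigenvalue A x \<and> x > 0}. order x (char_poly A))"

definition i_plus :: "nat \<Rightarrow> (nat \<Rightarrow> nat \<Rightarrow> bool) \<Rightarrow> (nat \<Rightarrow> nat \<Rightarrow> real) \<Rightarrow> nat" where
  "i_plus n E sg = pos_inertia (adj_matrix n E sg)"

definition connected_graph :: "nat \<Rightarrow> (nat \<Rightarrow> nat \<Rightarrow> bool) \<Rightarrow> bool" where
  "connected_graph n E \<longleftrightarrow> (\<forall>i<n. \<forall>j<n. E\<^sup>*\<^sup>* i j)"

definition is_cycle :: "nat \<Rightarrow> (nat \<Rightarrow> nat \<Rightarrow> bool) \<Rightarrow> nat list \<Rightarrow> bool" where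
  "is_cycle n E cs \<longleftrightarrow> length cs \<ge> 3 \<and> distinct cs \<and> set cs \<subseteq> {0..<n} \<and>
     (\<forall>i<length cs. E (cs ! i) (cs ! ((i + 1) mod length cs)))"

definition has_cycle :: "nat \<Rightarrow> (nat \<Rightarrow> nat \<Rightarrow> bool) \<Rightarrow> bool" where
  "has_cycle n E \<longleftrightarrow> (\<exists>cs. is_cycle n E cs)"

definition girth :: "nat \<Rightarrow> (nat \<Rightarrow> nat \<Rightarrow> bool) \<Rightarrow> nat" where
  "girth n E = (LEAST k. \<exists>cs. is_cycle n E cs \<and> length cs = k)"

definition cycle_sign :: "(nat \<Rightarrow> nat \<Rightarrow> real) \<Rightarrow> nat list \<Rightarrow> real" where
  "cycle_sign sg cs = (\<Prod>i<length cs. sg (cs ! i) (cs ! ((i + 1) mod length cs)))"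

definition balanced_cycle :: "(nat \<Rightarrow> nat \<Rightarrow> real) \<Rightarrow> nat list \<Rightarrow> bool" where
  "balanced_cycle sg cs \<longleftrightarrow> cycle_sign sg cs = 1"

definition graph_is_cycle :: "nat \<Rightarrow> (nat \<Rightarrow> nat \<Rightarrow> bool) \<Rightarrow> nat list \<Rightarrow> bool" where
  "graph_is_cycle n E cs \<longleftrightarrow> is_cycle n E cs \<and> set cs = {0..<n} \<and>
     (\<forall>u v. E u v \<longleftrightarrow> (\<exists>i<length cs. (u = cs ! i \<and> v = cs ! ((i + 1) mod length cs)) \<or>
                                         (v = cs ! i \<and> u = cs ! ((i + 1) mod length cs))))"

text \<open>(G, sg) is switching equivalent to (K_{n_1,...,n_l}, +) for some l >= 2:
  there is a vertex labelling by parts 0..l-1 (all parts nonempty) such that G is the complete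
  multipartite graph w.r.t. these parts, and a switching theta making every edge positive.\<close>
definition switching_equiv_complete_multipartite ::
  "nat \<Rightarrow> (nat \<Rightarrow> nat \<Rightarrow> bool) \<Rightarrow> (nat \<Rightarrow> nat \<Rightarrow> real) \<Rightarrow> bool" where
  "switching_equiv_complete_multipartite n E sg \<longleftrightarrow>
     (\<exists>(l::nat) (part::nat \<Rightarrow> nat). l \<ge> 2 \<and> part ` {0..<n} = {0..<l} \<and>
        (\<forall>i<n. \<forall>j<n. E i j \<longleftrightarrow> part i \<noteq> part j) \<and>
        (\<exists>\<theta>::nat \<Rightarrow> real. (\<forall>i<n. \<theta> i = 1 \<or> \<theta> i = -1) \<and>
           (\<forall>i j. E i j \<longrightarrow> \<theta> i * sg i j * \<theta> j = 1)))"

end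

theory Submission
  imports Defs "Jordan_Normal_Form.Schur_Decomposition"
begin

text \<open>By the spectral theorem, \<open>i\<^sub>+\<close> is the largest dimension of a space on which the quadratic form of
  the adjacency matrix is positive definite. Adding a pendant edge to an induced subgraph raises this
  dimension by one, so an induced path on \<open>2k\<close> vertices contributes \<open>k\<close>; a shortest cycle is chordless
  and contains such a path with \<open>2k \<in> {g - 1, g - 2}\<close>, which is the lower bound.

  If equality holds and \<open>g \<ge> 5\<close>, a vertex outside the shortest cycle would have exactly one
  neighbour on it, and pendant edge plus path would give one dimension too many; so the graph is
  the cycle, whose inertia is computed by switching it to a cycle with at most one negative edge.
  If \<open>g \<le> 4\<close>, equality means \<open>i\<^sub>+ = 1\<close>: a pendant edge argument shows that every edge dominates the
  graph, so that non-adjacency is an equivalence relation, and triangles and induced quadrangles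
  are balanced because unbalanced ones have \<open>i\<^sub>+ = 2\<close>. Conversely, the form of an all-positive
  complete multipartite graph is \<open>(\<Sum>x)\<^sup>2\<close> minus a sum of squares.\<close>

section \<open>Inertia of real symmetric matrices\<close>

lemma symmetric_mat_eigenvalue_exists:
  fixes A :: "real mat"
  assumes A: "A \<in> carrier_mat n n" and sym: "A\<^sup>T = A" and n: "n \<noteq> 0"
  shows "\<exists>e. eigenvalue A e"
proof -
  define C where "C = map_mat complex_of_real A"
  have C: "C \<in> carrier_mat n n" using A by (simp add: C_def)
  have symA: "A $$ (i, j) = A $$ (j, i)" if "i < n" "j < n" for i j
    using that A index_transpose_mat(1)[of j A i] sym by auto
  obtain as where as: "char_poly C = (\<Prod>a\<leftarrow>as. [:- a, 1:])" "length as = n"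
    using char_poly_factorized[OF C] by blast
  then obtain a where "a \<in> set as" using n by (cases as) auto
  then have "poly (char_poly C) a = 0"
    by (auto simp: as poly_prod_list prod_list_zero_iff)
  then have "eigenvalue C a" using eigenvalue_root_char_poly[OF C] by simp
  then obtain z where z: "z \<in> carrier_vec n" "z \<noteq> 0\<^sub>v n" "C *\<^sub>v z = a \<cdot>\<^sub>v z"
    using C unfolding eigenvalue_def eigenvector_def by auto
  have row: "(\<Sum>j<n. of_real (A $$ (i, j)) * z $ j) = a * z $ i" if "i < n" for i
  proof -
    have "(C *\<^sub>v z) $ i = (a \<cdot>\<^sub>v z) $ i" using z by simp
    then show ?thesis using that z C A
      by (auto simp: scalar_prod_def C_def lessThan_atLeast0)
  qed
  \<comment> \<open>\<open>N\<close> is the squared norm of the complex eigenvector and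
    \<open>S\<close> its Hermitian form. Symmetry of \<open>A\<close> makes \<open>S = a * N\<close>
    self-conjugate, so \<open>a\<close> is real.\<close>
  define N where "N = (\<Sum>i<n. z $ i * cnj (z $ i))"
  define S where "S = (\<Sum>i<n. \<Sum>j<n. of_real (A $$ (i, j)) * z $ j * cnj (z $ i))"
  have S: "S = a * N"
    unfolding S_def N_def sum_distrib_left
    by (rule sum.cong) (auto simp: row sum_distrib_right[symmetric])
  have "cnj S = (\<Sum>i<n. \<Sum>j<n. of_real (A $$ (i, j)) * cnj (z $ j) * z $ i)"
    by (simp add: S_def)
  also have "\<dots> = (\<Sum>j<n. \<Sum>i<n. of_real (A $$ (i, j)) * cnj (z $ j) * z $ i)"
    by (rule sum.swap)
  also have "\<dots> = S"
    unfolding S_def by (intro sum.cong refl) (auto simp: symA)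
  finally have "cnj S = S" .
  moreover have "cnj N = N" by (simp add: N_def mult.commute)
  ultimately have "cnj a * N = a * N" using S by (metis complex_cnj_mult)
  moreover have "N \<noteq> 0"
  proof
    assume "N = 0"
    then have "(\<Sum>i<n. (cmod (z $ i))\<^sup>2) = 0"
      by (simp only: N_def complex_norm_square[symmetric] of_real_sum[symmetric] of_real_eq_0_iff)
    then have "\<forall>i<n. z $ i = 0" by (auto simp: sum_nonneg_eq_0_iff)
    then show False using z by (auto intro!: eq_vecI)
  qed
  ultimately have "cnj a = a" by simp
  then obtain e where e: "a = of_real e" by (metis Reals_cnj_iff Reals_cases)
  \<comment> \<open>\<open>z\<close> may be non-real, so no real eigenvector is read off from it;
    instead the real root \<open>e\<close> passes to the characteristic polynomial of
    \<open>A\<close> itself.\<close>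
  have "char_poly C = map_poly complex_of_real (char_poly A)"
    unfolding C_def by (rule of_real_hom.char_poly_hom[OF A])
  then have "complex_of_real (poly (char_poly A) e) = 0"
    using \<open>poly (char_poly C) a = 0\<close> e by (simp del: of_real_0)
  then show ?thesis using eigenvalue_root_char_poly[OF A] by auto
qed

text \<open>Gram-Schmidt leaves the first vector of a basis unchanged, so completing
  \<open>v\<close> to a basis, orthogonalising and normalising only rescales
  \<open>v\<close>.\<close>

lemma orthogonal_mat_with_first_col:
  fixes v :: "real vec"
  assumes v: "v \<in> carrier_vec n" and v0: "v \<noteq> 0\<^sub>v n" and n: "n \<noteq> 0"
  shows "\<exists>W c. W \<in> carrier_mat n n \<and> W\<^sup>T * W = 1\<^sub>m n \<and> col W 0 = c \<cdot>\<^sub>v v"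
proof -
  interpret cof_vec_space n "TYPE(real)" .
  define b where "b = basis_completion v"
  note bc = basis_completion[OF v v0, folded b_def]
  obtain vs where bv: "b = v # vs" using bc n by (cases b) auto
  define ws where "ws = gram_schmidt n b"
  have ws: "set ws \<subseteq> carrier_vec n" "corthogonal ws" "length ws = n"
    using gram_schmidt_result[OF bc(2) bc(4) bc(5) refl] bc(6) by (auto simp: ws_def)
  have hd: "ws ! 0 = v"
    using gram_schmidt_hd[OF v, of vs, folded bv ws_def] ws(3) n hd_conv_nth[of ws] by fastforce
  have wsc: "ws ! i \<in> carrier_vec n" if "i < n" for i using ws that by auto
  define r where "r i = 1 / sqrt (ws ! i \<bullet> ws ! i)" for i
  define W where "W = mat_of_cols n (map (\<lambda>i. r i \<cdot>\<^sub>v ws ! i) [0..<n])"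
  have W: "W \<in> carrier_mat n n" by (simp add: W_def mat_of_cols_def)
  have colW: "col W i = r i \<cdot>\<^sub>v ws ! i" if "i < n" for i
    using that wsc by (simp add: W_def)
  have "W\<^sup>T * W = 1\<^sub>m n"
  proof (rule eq_matI)
    fix i j assume "i < dim_row (1\<^sub>m n :: real mat)" "j < dim_col (1\<^sub>m n :: real mat)"
    then have ij: "i < n" "j < n" by auto
    have orth: "(ws ! i \<bullet> ws ! j = 0) = (i \<noteq> j)"
      using corthogonalD[OF ws(2), of i j] ij ws(3)
      by (simp add: scalar_prod_def)
    have pos: "ws ! i \<bullet> ws ! i \<ge> 0"
      by (auto simp: scalar_prod_def intro: sum_nonneg)
    have "(W\<^sup>T * W) $$ (i, j) = r i * (r j * (ws ! i \<bullet> ws ! j))"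
      using ij W by (simp add: colW  smult_scalar_prod_distrib[OF wsc smult_carrier_vec[THEN iffD2, OF wsc]] scalar_prod_smult_distrib[OF wsc wsc])
    also have "\<dots> = 1\<^sub>m n $$ (i, j)"
    proof (cases "i = j")
      case True
      then have "ws ! i \<bullet> ws ! i > 0" using orth pos by (simp add: less_le)
      then show ?thesis using True ij
        by (simp add: r_def divide_simps)
    qed (use orth ij in auto)
    finally show "(W\<^sup>T * W) $$ (i, j) = 1\<^sub>m n $$ (i, j)" .
  qed (use W in auto)
  then show ?thesis using W colW[of 0] n hd by auto
qed

text \<open>Deflation: an orthogonal \<open>W\<close> with an eigenvector as first column makes the
  first column of \<open>W\<^sup>T * A * W\<close> a multiple of the first unit vector; by symmetry
  so is the first row, and the induction hypothesis diagonalises the remaining block.\<close>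

theorem symmetric_mat_diagonalization:
  fixes A :: "real mat"
  assumes "A \<in> carrier_mat n n" "A\<^sup>T = A"
  shows "\<exists>P d. P \<in> carrier_mat n n \<and> P\<^sup>T * P = 1\<^sub>m n \<and> P\<^sup>T * A * P = mat_diag n d"
  using assms
proof (induction n arbitrary: A)
  case 0
  then show ?case by (intro exI[of _ "1\<^sub>m 0"] exI[of _ "\<lambda>_. 0"]) (auto simp: mat_diag_def)
next
  case (Suc m)
  let ?n = "Suc m"
  note A = Suc.prems(1) and sym = Suc.prems(2)
  obtain e v where v: "v \<in> carrier_vec ?n" "v \<noteq> 0\<^sub>v ?n" "A *\<^sub>v v = e \<cdot>\<^sub>v v"
    using symmetric_mat_eigenvalue_exists[OF A sym] A unfolding eigenvalue_def eigenvector_def by auto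
  obtain W c where W: "W \<in> carrier_mat ?n ?n" "W\<^sup>T * W = 1\<^sub>m ?n" "col W 0 = c \<cdot>\<^sub>v v"
    using orthogonal_mat_with_first_col[OF v(1,2)] by auto
  have WT: "W\<^sup>T \<in> carrier_mat ?n ?n" using W by simp
  define B where "B = W\<^sup>T * A * W"
  have B: "B \<in> carrier_mat ?n ?n" using W A by (simp add: B_def)
  have symB: "B\<^sup>T = B"
    by (simp add: B_def assoc_mult_mat[OF WT A W(1)] transpose_mult[OF WT mult_carrier_mat[OF A W(1)]]
        transpose_mult[OF A W(1)] sym)
  have symB': "B $$ (i, j) = B $$ (j, i)" if "i < ?n" "j < ?n" for i j
    using that B index_transpose_mat(1)[of j B i] symB by auto
  have col0: "B $$ (i, 0) = (if i = 0 then e else 0)" if i: "i < ?n" for i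
  proof -
    have "B $$ (i, 0) = (W\<^sup>T * (A * W)) $$ (i, 0)"
      using assoc_mult_mat[OF WT A W(1)] by (simp add: B_def)
    also have "\<dots> = col W i \<bullet> (A *\<^sub>v col W 0)"
      using i W(1) A by (simp add: mult_mat_vec_def)
    also have "A *\<^sub>v col W 0 = e \<cdot>\<^sub>v col W 0"
      using v A W(3) by (simp add: mult_mat_vec smult_smult_assoc mult.commute)
    also have "col W i \<bullet> (e \<cdot>\<^sub>v col W 0) = e * (W\<^sup>T * W) $$ (i, 0)"
      using i W(1) by simp
    finally show ?thesis using i W(2) by simp
  qed
  define B' where "B' = mat m m (\<lambda>(i, j). B $$ (Suc i, Suc j))"
  have B': "B' \<in> carrier_mat m m" by (simp add: B'_def)
  have "B'\<^sup>T = B'" using symB' by (auto simp: B'_def intro!: eq_matI)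
  from Suc.IH[OF B' this] obtain P d where
    P: "P \<in> carrier_mat m m" "P\<^sup>T * P = 1\<^sub>m m" "P\<^sup>T * B' * P = mat_diag m d" by auto
  define Q where "Q = four_block_mat (1\<^sub>m 1) (0\<^sub>m 1 m) (0\<^sub>m m 1) P"
  have Q: "Q \<in> carrier_mat ?n ?n" using P by (auto simp: Q_def)
  have QT: "Q\<^sup>T = four_block_mat (1\<^sub>m 1) (0\<^sub>m 1 m) (0\<^sub>m m 1) (P\<^sup>T)"
    unfolding Q_def using P(1)
    by (subst transpose_four_block_mat[of _ 1 1 _ m _ m]) auto
  have Bblock: "B = four_block_mat (mat 1 1 (\<lambda>_. e)) (0\<^sub>m 1 m) (0\<^sub>m m 1) B'"
    by (rule eq_matI) (use B in \<open>auto simp: B'_def col0 symB'[of 0]\<close>)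
  have QQ: "Q\<^sup>T * Q = 1\<^sub>m ?n"
    unfolding QT unfolding Q_def using P
    by (subst mult_four_block_mat[of _ 1 1 _ m _ m _ _ 1 _ m]) auto
  have QBQ: "Q\<^sup>T * B * Q = mat_diag ?n (\<lambda>i. if i = 0 then e else d (i - 1))"
  proof -
    have "Q\<^sup>T * B = four_block_mat (mat 1 1 (\<lambda>_. e)) (0\<^sub>m 1 m) (0\<^sub>m m 1) (P\<^sup>T * B')"
      unfolding QT Bblock using P B'
      by (subst mult_four_block_mat[of _ 1 1 _ m _ m _ _ 1 _ m]) auto
    moreover have "\<dots> * Q = four_block_mat (mat 1 1 (\<lambda>_. e)) (0\<^sub>m 1 m) (0\<^sub>m m 1) (P\<^sup>T * B' * P)"
      unfolding Q_def using P(1,2) B'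
      by (subst mult_four_block_mat[of _ 1 1 _ m _ m _ _ 1 _ m]) auto
    moreover have "\<dots> = mat_diag ?n (\<lambda>i. if i = 0 then e else d (i - 1))"
      unfolding P(3) by (rule eq_matI) (auto simp: mat_diag_def)
    ultimately show ?thesis by simp
  qed
  have "(W * Q)\<^sup>T * (W * Q) = 1\<^sub>m ?n"
  proof -
    have "(W * Q)\<^sup>T * (W * Q) = Q\<^sup>T * (W\<^sup>T * W) * Q"
      using W(1) Q by (simp add: transpose_mult[of _ ?n ?n] assoc_mult_mat[of _ ?n ?n _ ?n _ ?n])
    then show ?thesis using W(2) Q QQ by simp
  qed
  moreover have "(W * Q)\<^sup>T * A * (W * Q) = Q\<^sup>T * B * Q"
    using W(1) Q A by (simp add: B_def transpose_mult[of _ ?n ?n] assoc_mult_mat[of _ ?n ?n _ ?n _ ?n])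
  ultimately show ?case using QBQ W(1) Q by (intro exI[of _ "W * Q"]) auto
qed

text \<open>Gaussian elimination, one equation per induction step. Arbitrary index sets allow a
  pivot unknown to be removed, and later the unknowns to be indexed by positive eigenvalues.\<close>

lemma homogeneous_system_nontrivial_solution:
  fixes M :: "'j \<Rightarrow> 'i \<Rightarrow> real"
  assumes "finite J" "finite I" "card J < card I"
  shows "\<exists>c. (\<exists>i\<in>I. c i \<noteq> 0) \<and> (\<forall>j\<in>J. (\<Sum>i\<in>I. M j i * c i) = 0)"
  using assms
proof (induction J arbitrary: I M rule: finite_induct)
  case empty
  then have "I \<noteq> {}" by auto
  then show ?case by (intro exI[of _ "\<lambda>_. 1"]) auto
next
  case (insert j J)
  show ?case
  proof (cases "\<forall>i\<in>I. M j i = 0")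
    case True
    have "card J < card I" using insert by simp
    from insert.IH[OF \<open>finite I\<close> this, of M] True show ?thesis by auto
  next
    case False
    then obtain p where p: "p \<in> I" "M j p \<noteq> 0" by auto
    let ?I = "I - {p}"
    \<comment> \<open>The remaining equations after equation \<open>j\<close> has been used to
      eliminate the unknown \<open>p\<close>.\<close>
    define N where "N l i = M l i - M l p * M j i / M j p" for l i
    have "card J < card ?I" using insert p by simp
    from insert.IH[OF _ this, of N] insert.prems obtain c where
      c: "\<exists>i\<in>?I. c i \<noteq> 0" "\<forall>l\<in>J. (\<Sum>i\<in>?I. N l i * c i) = 0" by auto
    define s where "s = (\<Sum>i\<in>?I. M j i * c i)"
    \<comment> \<open>Equation \<open>j\<close> forces this value of the pivot unknown.\<close>
    define c' where "c' = c(p := - s / M j p)"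
    have split: "(\<Sum>i\<in>I. M l i * c' i) = (\<Sum>i\<in>?I. M l i * c i) - M l p * s / M j p" for l
      using insert.prems(1) p(1) by (simp add: sum.remove[of I p] c'_def)
    have "(\<Sum>i\<in>I. M l i * c' i) = 0" if "l \<in> J" for l
    proof -
      have "0 = (\<Sum>i\<in>?I. N l i * c i)" using c that by simp
      also have "\<dots> = (\<Sum>i\<in>?I. M l i * c i - M l p / M j p * (M j i * c i))"
        by (intro sum.cong) (auto simp: N_def field_simps)
      also have "\<dots> = (\<Sum>i\<in>?I. M l i * c i) - M l p / M j p * s"
        by (simp add: sum_subtractf sum_distrib_left s_def)
      finally show ?thesis using split by simp
    qed
    moreover have "(\<Sum>i\<in>I. M j i * c' i) = 0" using split[of j] p by (simp add: s_def)
    moreover have "\<exists>i\<in>I. c' i \<noteq> 0" using c(1) by (auto simp: c'_def)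
    ultimately show ?thesis by (intro exI[of _ c']) auto
  qed
qed

section \<open>Positive inertia in terms of the quadratic form\<close>

definition quad_form :: "nat \<Rightarrow> real mat \<Rightarrow> (nat \<Rightarrow> real) \<Rightarrow> real" where
  "quad_form n A x = (\<Sum>i<n. \<Sum>j<n. A $$ (i, j) * x i * x j)"

lemma order_prod_linear_factors:
  fixes d :: "nat \<Rightarrow> real"
  shows "Polynomial.order x (\<Prod>i<n. [:- d i, 1:]) = card {i. i < n \<and> d i = x}"
proof (induction n)
  case (Suc n)
  have nz: "(\<Prod>i<n. [:- d i, 1:]) * [:- d n, 1:] \<noteq> 0"
    by (simp del: mult_pCons_right)
  have o: "Polynomial.order x [:- d n, 1:] = (if d n = x then 1 else 0)"
    using order_power_n_n[of "d n" 1] by (auto intro: order_0I)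
  have "{i. i < Suc n \<and> d i = x} = {i. i < n \<and> d i = x} \<union> (if d n = x then {n} else {})"
    by (auto simp: less_Suc_eq)
  then have "card {i. i < Suc n \<and> d i = x} = card {i. i < n \<and> d i = x} + (if d n = x then 1 else 0)"
    by auto
  then show ?case using Suc order_mult[OF nz, of x] o by simp
qed (simp add: order_0I)

text \<open>Diagonalisation in coordinates: the \<open>u i\<close> are orthonormal eigenvectors with
  eigenvalues \<open>d i\<close>. Equal eigenvalues occupy several indices, so counting indices
  counts multiplicities.\<close>

lemma symmetric_mat_eigenbasis:
  fixes A :: "real mat"
  assumes A: "A \<in> carrier_mat n n" and sym: "A\<^sup>T = A"
  obtains u d where
    "\<And>i j. i < n \<Longrightarrow> j < n \<Longrightarrow> (\<Sum>a<n. u i a * u j a) = (if i = j then 1 else 0)"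
    "\<And>x. quad_form n A x = (\<Sum>i<n. d i * (\<Sum>a<n. u i a * x a)\<^sup>2)"
    "pos_inertia A = card {i. i < n \<and> 0 < d i}"
proof -
  obtain P d where P: "P \<in> carrier_mat n n" "P\<^sup>T * P = 1\<^sub>m n" and D: "P\<^sup>T * A * P = mat_diag n d"
    using symmetric_mat_diagonalization[OF assms] by auto
  have PT: "P\<^sup>T \<in> carrier_mat n n" using P by simp
  have PP: "P * P\<^sup>T = 1\<^sub>m n" using mat_mult_left_right_inverse[OF PT P(1) P(2)] .
  have "P * mat_diag n d * P\<^sup>T = (P * P\<^sup>T) * A * (P * P\<^sup>T)"
    unfolding D[symmetric] using P(1) A by (simp add: assoc_mult_mat[of _ n n _ n _ n])
  then have AD: "A = P * mat_diag n d * P\<^sup>T" using A by (simp add: PP)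
  define u where "u i a = P $$ (a, i)" for i a
  have orth: "(\<Sum>a<n. u i a * u j a) = (if i = j then 1 else 0)" if "i < n" "j < n" for i j
  proof -
    have "(P\<^sup>T * P) $$ (i, j) = (\<Sum>a<n. u i a * u j a)"
      using that P(1) by (simp add: scalar_prod_def u_def lessThan_atLeast0)
    then show ?thesis using that P(2) by simp
  qed
  have entry: "A $$ (a, b) = (\<Sum>i<n. d i * u i a * u i b)" if "a < n" "b < n" for a b
  proof -
    have "A = mat n n (\<lambda>(i, j). P $$ (i, j) * d j) * P\<^sup>T"
      using AD by (simp add: mat_diag_mult_right[OF P(1)])
    then have "A $$ (a, b) = (mat n n (\<lambda>(i, j). P $$ (i, j) * d j) * P\<^sup>T) $$ (a, b)" by simp
    also have "\<dots> = (\<Sum>i<n. d i * u i a * u i b)"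
      using that P(1) by (auto simp: scalar_prod_def lessThan_atLeast0 u_def intro!: sum.cong)
    finally show ?thesis .
  qed
  have q: "quad_form n A x = (\<Sum>i<n. d i * (\<Sum>a<n. u i a * x a)\<^sup>2)" for x
  proof -
    have "quad_form n A x = (\<Sum>a<n. \<Sum>b<n. \<Sum>i<n. d i * (u i a * x a) * (u i b * x b))"
      unfolding quad_form_def
      by (intro sum.cong refl) (simp add: entry sum_distrib_right sum_distrib_left mult_ac)
    also have "\<dots> = (\<Sum>a<n. \<Sum>i<n. \<Sum>b<n. d i * (u i a * x a) * (u i b * x b))"
      by (intro sum.cong refl sum.swap)
    also have "\<dots> = (\<Sum>i<n. \<Sum>a<n. \<Sum>b<n. d i * (u i a * x a) * (u i b * x b))"
      by (rule sum.swap)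
    also have "\<dots> = (\<Sum>i<n. d i * (\<Sum>a<n. u i a * x a)\<^sup>2)"
      by (intro sum.cong refl) (simp add: power2_eq_square sum_product sum_distrib_left mult_ac)
    finally show ?thesis .
  qed
  have "similar_mat A (mat_diag n d)"
    by (rule similar_matI[of _ _ P "P\<^sup>T" n]) (use A P PT PP AD in auto)
  then have "char_poly A = char_poly (mat_diag n d)" by (rule char_poly_similar)
  also have "\<dots> = (\<Prod>a\<leftarrow>diag_mat (mat_diag n d). [:- a, 1:])"
    by (rule char_poly_upper_triangular[of _ n]) (auto simp: mat_diag_def)
  also have "\<dots> = (\<Prod>i<n. [:- d i, 1:])"
    by (simp add: diag_mat_def mat_diag_def prod.list_conv_set_nth lessThan_atLeast0)
  finally have cp: "char_poly A = (\<Prod>i<n. [:- d i, 1:])" .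
  have ev: "eigenvalue A x \<longleftrightarrow> (\<exists>i<n. d i = x)" for x
    using eigenvalue_root_char_poly[OF A, of x] by (auto simp: cp poly_prod)
  have "pos_inertia A = (\<Sum>x\<in>{x. eigenvalue A x \<and> x > 0}. card {i. i < n \<and> d i = x})"
    by (simp add: pos_inertia_def cp order_prod_linear_factors)
  also have "\<dots> = card (\<Union>x\<in>{x. eigenvalue A x \<and> x > 0}. {i. i < n \<and> d i = x})"
  proof (rule card_UN_disjoint[symmetric])
    have "{x. eigenvalue A x \<and> x > 0} \<subseteq> d ` {..<n}" by (auto simp: ev)
    then show "finite {x. eigenvalue A x \<and> x > 0}" by (rule finite_subset) auto
  qed auto
  also have "(\<Union>x\<in>{x. eigenvalue A x \<and> x > 0}. {i. i < n \<and> d i = x}) = {i. i < n \<and> 0 < d i}"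
    by (auto simp: ev)
  finally show thesis using that orth q by blast
qed

text \<open>With more vectors than positive eigenvalues, some nontrivial combination is orthogonal
  to every eigenvector of positive eigenvalue, and there the form is at most 0. Independence of the
  \<open>vs i\<close> is contained in the positivity for all nonzero coefficients.\<close>

lemma pos_inertia_lower_bound:
  fixes vs :: "nat \<Rightarrow> nat \<Rightarrow> real"
  assumes A: "A \<in> carrier_mat n n" and sym: "A\<^sup>T = A"
    and pos: "\<And>c. \<exists>i<k. c i \<noteq> 0 \<Longrightarrow> 0 < quad_form n A (\<lambda>a. \<Sum>i<k. c i * vs i a)"
  shows "k \<le> pos_inertia A"
proof (rule ccontr)
  assume less: "\<not> k \<le> pos_inertia A"
  obtain u d where "\<And>i j. i < n \<Longrightarrow> j < n \<Longrightarrow> (\<Sum>a<n. u i a * u j a) = (if i = j then 1 else 0)"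
    and q: "\<And>x. quad_form n A x = (\<Sum>i<n. d i * (\<Sum>a<n. u i a * x a)\<^sup>2)"
    and p: "pos_inertia A = card {i. i < n \<and> 0 < d i}"
    using symmetric_mat_eigenbasis[OF A sym] by blast
  have "card {i. i < n \<and> 0 < d i} < card {..<k}" using less p by simp
  from homogeneous_system_nontrivial_solution[OF _ _ this, of "\<lambda>j i. \<Sum>a<n. u j a * vs i a"]
  obtain c where c: "\<exists>i<k. c i \<noteq> 0"
    "\<And>j. j < n \<Longrightarrow> 0 < d j \<Longrightarrow> (\<Sum>i<k. (\<Sum>a<n. u j a * vs i a) * c i) = 0" by auto
  let ?x = "\<lambda>a. \<Sum>i<k. c i * vs i a"
  have "(\<Sum>a<n. u j a * ?x a) = (\<Sum>i<k. (\<Sum>a<n. u j a * vs i a) * c i)" for j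
    unfolding sum_distrib_left sum_distrib_right
    by (subst sum.swap) (simp add: mult_ac)
  then have "(\<Sum>a<n. u j a * ?x a) = 0" if "j < n" "0 < d j" for j using c that by simp
  then have "d j * (\<Sum>a<n. u j a * ?x a)\<^sup>2 \<le> 0" if "j < n" for j
    using that by (cases "0 < d j") (auto simp: mult_nonpos_nonneg)
  then have "quad_form n A ?x \<le> 0" unfolding q by (intro sum_nonpos) auto
  with pos[OF c(1)] show False by simp
qed

text \<open>Dual count: with more than \<open>k\<close> positive eigenvalues, the span of their
  eigenvectors would contain a nonzero vector killed by all \<open>k\<close> functionals, and there
  the form is positive.\<close>

lemma pos_inertia_upper_bound:
  fixes f :: "nat \<Rightarrow> nat \<Rightarrow> real"
  assumes A: "A \<in> carrier_mat n n" and sym: "A\<^sup>T = A"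
    and nonpos: "\<And>x. \<forall>i<k. (\<Sum>a<n. f i a * x a) = 0 \<Longrightarrow> quad_form n A x \<le> 0"
  shows "pos_inertia A \<le> k"
proof (rule ccontr)
  assume less: "\<not> pos_inertia A \<le> k"
  obtain u d where orth: "\<And>i j. i < n \<Longrightarrow> j < n \<Longrightarrow> (\<Sum>a<n. u i a * u j a) = (if i = j then 1 else 0)"
    and q: "\<And>x. quad_form n A x = (\<Sum>i<n. d i * (\<Sum>a<n. u i a * x a)\<^sup>2)"
    and p: "pos_inertia A = card {i. i < n \<and> 0 < d i}"
    using symmetric_mat_eigenbasis[OF A sym] by blast
  let ?I = "{i. i < n \<and> 0 < d i}"
  have "card {..<k} < card ?I" using less p by simp
  from homogeneous_system_nontrivial_solution[OF _ _ this, of "\<lambda>j i. \<Sum>a<n. f j a * u i a"]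
  obtain c where c: "\<exists>i\<in>?I. c i \<noteq> 0"
    "\<And>j. j < k \<Longrightarrow> (\<Sum>i\<in>?I. (\<Sum>a<n. f j a * u i a) * c i) = 0" by auto
  let ?x = "\<lambda>a. \<Sum>i\<in>?I. c i * u i a"
  have comb: "(\<Sum>a<n. w a * ?x a) = (\<Sum>i\<in>?I. (\<Sum>a<n. w a * u i a) * c i)" for w
    unfolding sum_distrib_left sum_distrib_right
    by (subst sum.swap) (simp add: mult_ac)
  have coord: "(\<Sum>a<n. u j a * ?x a) = (if j \<in> ?I then c j else 0)" if "j < n" for j
  proof -
    have "(\<Sum>a<n. u j a * ?x a) = (\<Sum>i\<in>?I. if j = i then c i else 0)"
      unfolding comb using that by (intro sum.cong) (auto simp: orth)
    also have "\<dots> = (if j \<in> ?I then c j else 0)" by (subst sum.delta') auto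
    finally show ?thesis .
  qed
  have nonneg: "0 \<le> d j * (\<Sum>a<n. u j a * ?x a)\<^sup>2" if "j < n" for j
    using that by (simp add: coord[OF that])
  obtain i where i: "i \<in> ?I" "c i \<noteq> 0" using c by auto
  have "0 < d i * (\<Sum>a<n. u i a * ?x a)\<^sup>2" using i coord[of i] by simp
  then have "0 < quad_form n A ?x"
    unfolding q using i nonneg by (intro sum_pos2[of _ i]) auto
  moreover have "quad_form n A ?x \<le> 0" using c(2) by (intro nonpos) (simp add: comb)
  ultimately show False by simp
qed

section \<open>Positive definite subspaces\<close>

text \<open>Forms are evaluated below by prescribing vertex values one at a time; this is the effect
  of one such change.\<close>

lemma quad_form_add_single:
  assumes sym: "\<And>i j. i < n \<Longrightarrow> j < n \<Longrightarrow> A $$ (i, j) = A $$ (j, i)" and v: "v < n"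
  shows "quad_form n A (\<lambda>a. x a + (if a = v then t else 0)) =
    quad_form n A x + 2 * t * (\<Sum>a<n. A $$ (v, a) * x a) + t\<^sup>2 * A $$ (v, v)"
proof -
  let ?d = "\<lambda>a. if a = v then t else 0"
  have "quad_form n A (\<lambda>a. x a + ?d a) =
      (\<Sum>i<n. \<Sum>j<n. A $$ (i, j) * x i * x j) + (\<Sum>i<n. \<Sum>j<n. A $$ (i, j) * x i * ?d j)
      + (\<Sum>i<n. \<Sum>j<n. A $$ (i, j) * ?d i * x j) + (\<Sum>i<n. \<Sum>j<n. A $$ (i, j) * ?d i * ?d j)"
    unfolding quad_form_def sum.distrib[symmetric]
    by (intro sum.cong refl) (simp add: algebra_simps)
  also have "(\<Sum>i<n. \<Sum>j<n. A $$ (i, j) * x i * ?d j) = t * (\<Sum>a<n. A $$ (v, a) * x a)"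
    unfolding sum_distrib_left using v
    by (intro sum.cong refl) (simp add: sym if_distrib[of "\<lambda>z. _ * z"] sum.delta cong: if_cong)
  also have "(\<Sum>i<n. \<Sum>j<n. A $$ (i, j) * ?d i * x j) = (\<Sum>i<n. if i = v then t * (\<Sum>a<n. A $$ (v, a) * x a) else 0)"
    by (intro sum.cong refl) (simp add: sum_distrib_left mult_ac)
  also have "\<dots> = t * (\<Sum>a<n. A $$ (v, a) * x a)" using v by simp
  also have "(\<Sum>i<n. \<Sum>j<n. A $$ (i, j) * ?d i * ?d j) = (\<Sum>i<n. if i = v then A $$ (v, v) * t * t else 0)"
    using v by (intro sum.cong refl) (simp add: if_distrib[of "\<lambda>z. _ * z"] sum.delta cong: if_cong)
  also have "\<dots> = t\<^sup>2 * A $$ (v, v)" using v by (simp add: power2_eq_square)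
  finally show ?thesis by (simp add: quad_form_def)
qed

text \<open>A \<open>k\<close>-dimensional positive definite subspace, given by a basis. The support
  \<open>S\<close> is recorded so that an edge with one end seeing nothing in \<open>S\<close> can
  be attached later.\<close>

definition positive_on :: "nat \<Rightarrow> real mat \<Rightarrow> nat set \<Rightarrow> nat \<Rightarrow> bool" where
  "positive_on n A S k \<longleftrightarrow> (\<exists>vs. (\<forall>i<k. \<forall>a. a \<notin> S \<longrightarrow> vs i a = 0) \<and>
     (\<forall>c. (\<exists>i<k. c i \<noteq> 0) \<longrightarrow> 0 < quad_form n A (\<lambda>a. \<Sum>i<k. c i * vs i a)))"

lemma positive_on_0: "positive_on n A S 0"
  by (simp add: positive_on_def)

lemma positive_on_le_pos_inertia:
  assumes "A \<in> carrier_mat n n" "A\<^sup>T = A" "positive_on n A S k"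
  shows "k \<le> pos_inertia A"
  using pos_inertia_lower_bound[OF assms(1,2)] assms(3) unfolding positive_on_def by blast

lemma linear_combination_of_units:
  fixes L :: "(nat \<Rightarrow> real) \<Rightarrow> nat \<Rightarrow> real"
  assumes add: "\<And>c d a. L (\<lambda>i. c i + d i) a = L c a + L d a"
    and scale: "\<And>r c a. L (\<lambda>i. r * c i) a = r * L c a"
  shows "(\<Sum>i<k. c i * L (\<lambda>j. if j = i then 1 else 0) a) = L (\<lambda>i. if i < k then c i else 0) a"
proof (induction k)
  case 0
  show ?case using scale[of 0 "\<lambda>_. 0" a] by simp
next
  case (Suc k)
  have "(\<lambda>i. if i < Suc k then c i else 0) =
    (\<lambda>i. (if i < k then c i else 0) + c k * (if i = k then 1 else 0))"
    by (auto simp: less_Suc_eq)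
  then show ?case using Suc by (simp only: add scale sum.lessThan_Suc)
qed

text \<open>Lets a subspace be given by a linear parametrisation: the images under \<open>L\<close>
  of the unit vectors serve as basis.\<close>

lemma positive_on_linear:
  fixes L :: "(nat \<Rightarrow> real) \<Rightarrow> nat \<Rightarrow> real"
  assumes add: "\<And>c d a. L (\<lambda>i. c i + d i) a = L c a + L d a"
    and scale: "\<And>r c a. L (\<lambda>i. r * c i) a = r * L c a"
    and pos: "\<And>c. \<exists>i<k. c i \<noteq> 0 \<Longrightarrow> \<forall>i\<ge>k. c i = 0 \<Longrightarrow> 0 < quad_form n A (L c)"
  shows "positive_on n A UNIV k"
proof -
  have "(\<lambda>a. \<Sum>i<k. c i * L (\<lambda>j. if j = i then 1 else 0) a) = L (\<lambda>i. if i < k then c i else 0)" for c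
    by (rule ext) (rule linear_combination_of_units[OF add scale])
  then show ?thesis unfolding positive_on_def
    by (intro exI[of _ "\<lambda>i. L (\<lambda>j. if j = i then 1 else 0)"]) (auto intro!: pos)
qed

text \<open>If \<open>w\<close> is adjacent to \<open>v\<close> and to nothing in \<open>S\<close>, the value at \<open>w\<close> can be chosen so as to
  turn all terms involving \<open>v\<close> into the square of the value at \<open>v\<close>.\<close>

lemma positive_on_pendant:
  assumes sym: "\<And>i j. i < n \<Longrightarrow> j < n \<Longrightarrow> A $$ (i, j) = A $$ (j, i)"
    and diag: "A $$ (v, v) = 0" "A $$ (w, w) = 0"
    and vw: "v < n" "w < n" "v \<noteq> w" "v \<notin> S" "w \<notin> S"
    and A: "A $$ (w, v) \<noteq> 0" "\<And>a. a \<in> S \<Longrightarrow> a < n \<Longrightarrow> A $$ (w, a) = 0"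
    and S: "positive_on n A S k"
  shows "positive_on n A (insert v (insert w S)) (Suc k)"
proof -
  obtain vs where supp: "\<And>i a. i < k \<Longrightarrow> a \<notin> S \<Longrightarrow> vs i a = 0"
    and pos: "\<And>c. \<exists>i<k. c i \<noteq> 0 \<Longrightarrow> 0 < quad_form n A (\<lambda>a. \<Sum>i<k. c i * vs i a)"
    using S unfolding positive_on_def by blast
  define r where "r i = (\<Sum>b<n. A $$ (v, b) * vs i b)" for i
  define q where "q = A $$ (w, v)"
  define vs' where "vs' i a =
    (if i < k then vs i a + (if a = w then - r i / q else 0)
     else (if a = v then 1 else 0) + (if a = w then 1 / q else 0))" for i a
  have "0 < quad_form n A (\<lambda>a. \<Sum>i<Suc k. c i * vs' i a)" if c: "\<exists>i<Suc k. c i \<noteq> 0" for c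
  proof -
    define y where "y a = (\<Sum>i<k. c i * vs i a)" for a
    define t where "t = c k"
    define R where "R = (\<Sum>b<n. A $$ (v, b) * y b)"
    \<comment> \<open>\<open>s\<close> is the value that \<open>vs'\<close> produces at
      \<open>w\<close>. It solves \<open>q * s = t - R\<close>, so that
      \<open>2 * t * R + 2 * s * (q * t)\<close> collapses to \<open>2 * t\<^sup>2\<close>.\<close>
    define s where "s = (t - R) / q"
    define z where "z a = y a + (if a = v then t else 0)" for a
    have R: "R = (\<Sum>i<k. c i * r i)"
      unfolding R_def y_def r_def sum_distrib_left by (subst sum.swap) (simp add: mult_ac)
    have y0: "y a = 0" if "a \<notin> S" for a using that supp by (simp add: y_def)
    have "(\<Sum>i<Suc k. c i * vs' i a) = z a + (if a = w then s else 0)" for a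
      by (simp add: vs'_def z_def y_def t_def s_def R algebra_simps sum.distrib sum_subtractf
          sum_divide_distrib diff_divide_distrib sum_negf)
    then have "quad_form n A (\<lambda>a. \<Sum>i<Suc k. c i * vs' i a) =
        quad_form n A (\<lambda>a. z a + (if a = w then s else 0))" by simp
    also have "\<dots> = quad_form n A z + 2 * s * (\<Sum>a<n. A $$ (w, a) * z a)"
      using quad_form_add_single[OF sym vw(2)] diag by simp
    also have "(\<Sum>a<n. A $$ (w, a) * z a) = (\<Sum>a<n. if a = v then q * t else 0)"
      using A(2) y0 vw(4) by (intro sum.cong refl) (auto simp: z_def q_def)
    also have "\<dots> = q * t" using vw by simp
    also have "quad_form n A z = quad_form n A y + 2 * t * R"
      unfolding z_def using quad_form_add_single[OF sym vw(1)] diag by (simp add: R_def)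
    also have "quad_form n A y + 2 * t * R + 2 * s * (q * t) = quad_form n A y + 2 * t\<^sup>2"
      using A(1) by (simp add: s_def q_def field_simps power2_eq_square)
    finally have eq: "quad_form n A (\<lambda>a. \<Sum>i<Suc k. c i * vs' i a) = quad_form n A y + 2 * t\<^sup>2" .
    show ?thesis
    proof (cases "\<exists>i<k. c i \<noteq> 0")
      case True
      then show ?thesis using pos[of c] eq by (simp add: y_def[abs_def] add_pos_nonneg)
    next
      case False
      then have "y = (\<lambda>_. 0)" by (auto simp: y_def)
      moreover have "t \<noteq> 0" using False c by (auto simp: t_def less_Suc_eq)
      ultimately show ?thesis using eq by (simp add: quad_form_def)
    qed
  qed
  moreover have "vs' i a = 0" if "a \<notin> insert v (insert w S)" "i < Suc k" for i a
    using that supp by (auto simp: vs'_def)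
  ultimately show ?thesis unfolding positive_on_def by blast
qed

text \<open>The path grows by two vertices at a time: the last vertex sees only the one before it,
  so these two form a pendant edge over the first \<open>2 * k\<close>.\<close>

lemma positive_on_path:
  assumes sym: "\<And>i j. i < n \<Longrightarrow> j < n \<Longrightarrow> A $$ (i, j) = A $$ (j, i)"
    and diag: "\<And>i. i < n \<Longrightarrow> A $$ (i, i) = 0"
    and f: "inj_on f {..<2 * k}" "\<And>i. i < 2 * k \<Longrightarrow> f i < n"
    and edge: "\<And>i. Suc i < 2 * k \<Longrightarrow> A $$ (f i, f (Suc i)) \<noteq> 0"
    and nonedge: "\<And>i j. Suc i < j \<Longrightarrow> j < 2 * k \<Longrightarrow> A $$ (f i, f j) = 0"
  shows "positive_on n A (f ` {..<2 * k}) k"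
  using f edge nonedge
proof (induction k)
  case 0
  show ?case by (rule positive_on_0)
next
  case (Suc k)
  let ?v = "f (2 * k)" and ?w = "f (Suc (2 * k))"
  have IH: "positive_on n A (f ` {..<2 * k}) k"
    by (rule Suc.IH) (use Suc.prems in \<open>auto intro: inj_on_subset\<close>)
  have inj: "f i = f j \<longleftrightarrow> i = j" if "i < 2 * Suc k" "j < 2 * Suc k" for i j
    using Suc.prems(1) that by (auto dest: inj_onD)
  have lt: "?v < n" "?w < n" using Suc.prems(2) by auto
  have "positive_on n A (insert ?v (insert ?w (f ` {..<2 * k}))) (Suc k)"
  proof (rule positive_on_pendant[OF sym diag[OF lt(1)] diag[OF lt(2)] lt])
    show "A $$ (?w, ?v) \<noteq> 0" using Suc.prems(3)[of "2 * k"] sym lt by auto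
    show "A $$ (?w, a) = 0" if "a \<in> f ` {..<2 * k}" "a < n" for a
      using that Suc.prems(4)[of _ "Suc (2 * k)"] sym[OF lt(2)] by auto
  qed (use IH in \<open>auto simp: inj\<close>)
  moreover have "f ` {..<2 * Suc k} = insert ?v (insert ?w (f ` {..<2 * k}))"
    by (auto simp: lessThan_Suc)
  ultimately show ?case by simp
qed

section \<open>Shortest cycles\<close>

lemma signed_graphD:
  assumes "signed_graph n E sg" "E i j"
  shows "i < n \<and> j < n" "E j i" "i \<noteq> j" "sg i j = 1 \<or> sg i j = -1" "sg j i = sg i j"
  using assms unfolding signed_graph_def by metis+

lemma is_cycle_rotate:
  assumes "is_cycle n E cs"
  shows "is_cycle n E (rotate m cs)"
proof -
  let ?l = "length cs"
  have l: "?l \<ge> 3" using assms by (simp add: is_cycle_def)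
  have "E (rotate m cs ! i) (rotate m cs ! ((i + 1) mod ?l))" if i: "i < ?l" for i
  proof -
    have "(m + i) mod ?l < ?l" using l by (intro mod_less_divisor) linarith
    then have "E (cs ! ((m + i) mod ?l)) (cs ! (((m + i) mod ?l + 1) mod ?l))"
      using assms by (auto simp: is_cycle_def)
    moreover have "((m + i) mod ?l + 1) mod ?l = (m + (i + 1) mod ?l) mod ?l"
      by (simp add: mod_simps)
    moreover have "(i + 1) mod ?l < ?l" using l by (intro mod_less_divisor) linarith
    ultimately show ?thesis using i by (simp add: nth_rotate)
  qed
  then show ?thesis using assms by (simp add: is_cycle_def)
qed

lemma is_cycle_edge:
  assumes "is_cycle n E cs" "Suc i < length cs"
  shows "E (cs ! i) (cs ! Suc i)"
  using assms(1)[unfolded is_cycle_def] assms(2) by (metis Suc_eq_plus1 Suc_lessD mod_less)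

lemma is_cycle_chord:
  assumes sg: "signed_graph n E sg" and cyc: "is_cycle n E cs"
    and ij: "Suc i < j" "j < length cs" and chord: "E (cs ! i) (cs ! j)"
  shows "is_cycle n E (take (Suc (j - i)) (drop i cs))"
proof -
  let ?d = "take (Suc (j - i)) (drop i cs)"
  have len: "length ?d = Suc (j - i)" using ij by simp
  have "E (?d ! k) (?d ! ((k + 1) mod length ?d))" if "k < length ?d" for k
  proof (cases "k = j - i")
    case True
    then show ?thesis using len ij chord sg by (simp add: signed_graph_def)
  next
    case False
    then have "k < j - i" using that len by simp
    then show ?thesis using is_cycle_edge[OF cyc, of "i + k"] ij by simp
  qed
  moreover have "set ?d \<subseteq> set cs" by (meson order.trans set_drop_subset set_take_subset)
  ultimately show ?thesis using cyc ij len by (auto simp: is_cycle_def)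
qed

text \<open>The path from position 0 to position \<open>j\<close> is closed through the outer vertex
  \<open>z\<close>, giving a cycle of length \<open>j + 2\<close>.\<close>

lemma is_cycle_shortcut:
  assumes sg: "signed_graph n E sg" and cyc: "is_cycle n E cs"
    and z: "z \<notin> set cs" "E z (cs ! 0)" "E z (cs ! j)" and j: "0 < j" "j < length cs"
  shows "is_cycle n E (z # take (Suc j) cs)"
proof -
  let ?d = "z # take (Suc j) cs"
  have len: "length ?d = j + 2" using j by simp
  have "E (?d ! k) (?d ! ((k + 1) mod length ?d))" if "k < length ?d" for k
  proof -
    have "k < j + 2" using that len by simp
    then consider "k = 0" | "k = Suc j" | l where "k = Suc l" "l < j"
      by (cases k) (auto simp: less_Suc_eq)
    then show ?thesis
    proof cases
      case 3
      then show ?thesis using is_cycle_edge[OF cyc, of l] j by simp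
    qed (use z sg j in \<open>auto simp: signed_graph_def\<close>)
  qed
  moreover have "set (take (Suc j) cs) \<subseteq> set cs" by (rule set_take_subset)
  moreover have "z < n" using z sg by (auto simp: signed_graph_def)
  ultimately show ?thesis using cyc z j len by (auto simp: is_cycle_def)
qed

lemma girth_le_length:
  assumes "is_cycle n E cs"
  shows "girth n E \<le> length cs"
  unfolding girth_def by (rule Least_le) (use assms in blast)

lemma girth_cycle_exists:
  assumes "has_cycle n E"
  obtains cs where "is_cycle n E cs" "length cs = girth n E"
proof -
  have "\<exists>k cs. is_cycle n E cs \<and> length cs = k" using assms by (auto simp: has_cycle_def)
  then have "\<exists>cs. is_cycle n E cs \<and> length cs = girth n E"
    unfolding girth_def by (rule LeastI_ex)
  then show thesis using that by blast
qed

text \<open>A chord between positions \<open>i\<close> and \<open>j\<close> closes a cycle of length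
  \<open>j - i + 1\<close>, which is below the girth unless these are the first and last
  positions.\<close>

lemma shortest_cycle_chordless:
  assumes sg: "signed_graph n E sg" and cyc: "is_cycle n E cs" and min: "length cs = girth n E"
    and ij: "i < j" "j < length cs" and E: "E (cs ! i) (cs ! j)"
  shows "j = Suc i \<or> (i = 0 \<and> j = length cs - 1)"
proof (rule ccontr)
  assume neg: "\<not> ?thesis"
  then have "Suc i < j" using ij by simp
  then have "girth n E \<le> Suc (j - i)"
    using girth_le_length[OF is_cycle_chord[OF sg cyc _ ij(2) E]] ij by simp
  then show False using neg min ij by auto
qed

text \<open>Two neighbours of \<open>z\<close> split the cycle into two arcs; closed through
  \<open>z\<close> they give cycles of lengths \<open>j + 2\<close> and \<open>g - j + 2\<close>,
  where \<open>g\<close> is the girth. If both are at least \<open>g\<close>, then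
  \<open>g \<le> 4\<close>.\<close>

lemma shortest_cycle_neighbour_unique:
  assumes sg: "signed_graph n E sg" and cyc: "is_cycle n E cs" and min: "length cs = girth n E"
    and g: "5 \<le> girth n E"
    and z: "z \<notin> set cs" "E z (cs ! 0)" "E z (cs ! j)" and j: "j < length cs"
  shows "j = 0"
proof (rule ccontr)
  assume j0: "j \<noteq> 0"
  have "girth n E \<le> j + 2"
    using girth_le_length[OF is_cycle_shortcut[OF sg cyc z _ j]] j0 j by simp
  moreover have "girth n E \<le> length cs - j + 2"
  proof -
    \<comment> \<open>The second arc runs from position \<open>j\<close> through the end to position
      0; rotating by \<open>j\<close> makes it an initial segment.\<close>
    have "rotate j cs ! 0 = cs ! j" "rotate j cs ! (length cs - j) = cs ! 0"
      using j j0 nth_rotate[of 0 cs j] nth_rotate[of "length cs - j" cs j] by fastforce+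
    then have "is_cycle n E (z # take (Suc (length cs - j)) (rotate j cs))"
      using j j0 z by (intro is_cycle_shortcut[OF sg is_cycle_rotate[OF cyc]]) auto
    from girth_le_length[OF this] j j0 show ?thesis by simp
  qed
  ultimately show False using min g j by simp
qed

section \<open>Adjacency matrices and the lower bound by the girth\<close>

lemma adj_matrix_carrier: "adj_matrix n E sg \<in> carrier_mat n n"
  by (simp add: adj_matrix_def)

lemma adj_matrix_index:
  "i < n \<Longrightarrow> j < n \<Longrightarrow> adj_matrix n E sg $$ (i, j) = (if E i j then sg i j else 0)"
  by (simp add: adj_matrix_def)

lemma adj_matrix_sym:
  assumes "signed_graph n E sg" "i < n" "j < n"
  shows "adj_matrix n E sg $$ (i, j) = adj_matrix n E sg $$ (j, i)"
  using assms by (auto simp: adj_matrix_index signed_graph_def)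

lemma adj_matrix_diag:
  assumes "signed_graph n E sg" "i < n"
  shows "adj_matrix n E sg $$ (i, i) = 0"
  using assms by (auto simp: adj_matrix_index signed_graph_def)

lemma adj_matrix_quad_form_add_single:
  assumes sg: "signed_graph n E sg" and v: "v < n"
  shows "quad_form n (adj_matrix n E sg) (\<lambda>a. x a + (if a = v then t else 0)) =
    quad_form n (adj_matrix n E sg) x + 2 * t * (\<Sum>a<n. adj_matrix n E sg $$ (v, a) * x a)"
  by (subst quad_form_add_single) (use v adj_matrix_sym[OF sg] adj_matrix_diag[OF sg v] in auto)

lemma adj_matrix_transpose:
  assumes "signed_graph n E sg"
  shows "(adj_matrix n E sg)\<^sup>T = adj_matrix n E sg"
  by (rule eq_matI) (use adj_matrix_sym[OF assms] in \<open>auto simp: adj_matrix_def\<close>)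

lemma adj_matrix_nonzero_iff:
  assumes "signed_graph n E sg" "i < n" "j < n"
  shows "adj_matrix n E sg $$ (i, j) \<noteq> 0 \<longleftrightarrow> E i j"
  using assms signed_graphD(4)[OF assms(1), of i j] by (auto simp: adj_matrix_index)

lemma positive_on_le_i_plus:
  assumes "signed_graph n E sg" "positive_on n (adj_matrix n E sg) S k"
  shows "k \<le> i_plus n E sg"
  using positive_on_le_pos_inertia[OF adj_matrix_carrier adj_matrix_transpose] assms
  by (simp add: i_plus_def)

text \<open>\<open>2 * k\<close> is one or two below the girth, so at least the last position is
  left out. This removes the closing edge, and the remaining vertices induce a path.\<close>

lemma positive_on_shortest_cycle:
  assumes sg: "signed_graph n E sg" and cyc: "is_cycle n E cs" and min: "length cs = girth n E"
  defines "k \<equiv> (girth n E - 1) div 2"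
  shows "positive_on n (adj_matrix n E sg) ((!) cs ` {..<2 * k}) k"
proof (rule positive_on_path)
  have k: "2 * k < length cs" using min cyc by (auto simp: k_def is_cycle_def)
  have lt: "cs ! i < n" if "i < length cs" for i
    using cyc that unfolding is_cycle_def by (metis atLeastLessThan_iff nth_mem subsetD)
  show "inj_on ((!) cs) {..<2 * k}"
    using cyc k by (auto simp: is_cycle_def intro!: inj_on_nth)
  show "cs ! i < n" if "i < 2 * k" for i using lt k that by simp
  show "adj_matrix n E sg $$ (cs ! i, cs ! Suc i) \<noteq> 0" if "Suc i < 2 * k" for i
    using that k lt is_cycle_edge[OF cyc, of i] adj_matrix_nonzero_iff[OF sg] by simp
  show "adj_matrix n E sg $$ (cs ! i, cs ! j) = 0" if "Suc i < j" "j < 2 * k" for i j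
    using that k lt shortest_cycle_chordless[OF sg cyc min, of i j]
      adj_matrix_nonzero_iff[OF sg, of "cs ! i" "cs ! j"] by auto
  show "adj_matrix n E sg $$ (i, i) = 0" if "i < n" for i
    using adj_matrix_diag[OF sg that] .
qed (rule adj_matrix_sym[OF sg])

lemma i_plus_girth_lower_bound:
  assumes "signed_graph n E sg" "has_cycle n E"
  shows "(girth n E - 1) div 2 \<le> i_plus n E sg"
  using girth_cycle_exists[OF assms(2)] positive_on_shortest_cycle[OF assms(1)]
    positive_on_le_i_plus[OF assms(1)] by metis

section \<open>Connected graphs with a vertex outside a shortest cycle\<close>

lemma connected_graph_exit_edge:
  assumes "connected_graph n E" "x \<in> S" "x < n" "y \<notin> S" "y < n"
  obtains a b where "a \<in> S" "b \<notin> S" "E a b"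
proof -
  have "E\<^sup>*\<^sup>* x y" using assms by (simp add: connected_graph_def)
  then have "y \<notin> S \<longrightarrow> (\<exists>a b. a \<in> S \<and> b \<notin> S \<and> E a b)"
    using assms(2) by (induction rule: rtranclp_induct) blast+
  then show thesis using assms that by blast
qed

text \<open>Connectivity yields an edge from a cycle vertex \<open>a\<close> to an outer vertex
  \<open>z\<close>. As \<open>a\<close> is the only neighbour of \<open>z\<close> on the cycle, this
  edge is pendant over a path of \<open>2 * ?k\<close> cycle vertices avoiding
  \<open>a\<close>.\<close>

lemma i_plus_shortest_cycle_not_spanning:
  assumes sg: "signed_graph n E sg" and conn: "connected_graph n E"
    and cyc: "is_cycle n E cs" and min: "length cs = girth n E"
    and g: "5 \<le> girth n E" and proper: "set cs \<noteq> {0..<n}"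
  shows "(girth n E - 1) div 2 < i_plus n E sg"
proof -
  let ?A = "adj_matrix n E sg" and ?k = "(girth n E - 1) div 2" and ?g = "girth n E"
  have sub: "set cs \<subseteq> {0..<n}" using cyc by (simp add: is_cycle_def)
  then obtain y where y: "y < n" "y \<notin> set cs" using proper by force
  have "cs ! 0 \<in> set cs" using g min by auto
  then obtain a z where az: "a \<in> set cs" "z \<notin> set cs" "E a z"
    using connected_graph_exit_edge[OF conn _ _ y(2,1)] sub by (metis atLeastLessThan_iff subsetD)
  have za: "E z a" and zn: "z < n" "a < n" using az sg by (auto simp: signed_graph_def)
  obtain m where m: "m < length cs" "cs ! m = a" using az by (auto simp: in_set_conv_nth)
  \<comment> \<open>Rotating by \<open>Suc m\<close> puts \<open>a\<close> in the last position,
    outside the path formed by the first \<open>2 * ?k\<close> vertices.\<close>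
  define ds where "ds = rotate (Suc m) cs"
  have ds: "is_cycle n E ds" "length ds = ?g" "set ds = set cs"
    using is_cycle_rotate[OF cyc, of "Suc m"] min by (auto simp: ds_def simp del: rotate_Suc)
  have last: "ds ! (?g - 1) = a"
    using m min nth_rotate[of "?g - 1" cs "Suc m"] g by (auto simp: ds_def simp del: rotate_Suc)
  have lt: "ds ! i < n" if "i < ?g" for i
    using ds sub that by (metis atLeastLessThan_iff nth_mem subsetD)
  \<comment> \<open>A further rotation brings \<open>a\<close> to position 0, where the uniqueness
    lemma expects the known neighbour.\<close>
  have nonadj: "\<not> E z (ds ! i)" if i: "i < ?g - 1" for i
  proof
    assume "E z (ds ! i)"
    moreover have "rotate (?g - 1) ds ! 0 = a" using last ds g nth_rotate[of 0 ds "?g - 1"] by simp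
    moreover have "rotate (?g - 1) ds ! Suc i = ds ! i"
      using i ds nth_rotate[of "Suc i" ds "?g - 1"] by auto
    ultimately have "Suc i = 0"
      using i ds az za
      by (intro shortest_cycle_neighbour_unique[OF sg is_cycle_rotate[OF ds(1), of "?g - 1"] _ g, of z]) auto
    then show False by simp
  qed
  have k: "2 * ?k \<le> ?g - 1" by simp
  have aS: "a \<notin> (!) ds ` {..<2 * ?k}"
  proof
    assume "a \<in> (!) ds ` {..<2 * ?k}"
    then obtain i where i: "i < 2 * ?k" "a = ds ! i" by auto
    have "distinct ds" using ds by (simp add: is_cycle_def)
    then have "i = ?g - 1"
      using i last ds(2) g k nth_eq_iff_index_eq[of ds i "?g - 1"] by linarith
    then show False using i k by simp
  qed
  have zS: "z \<notin> (!) ds ` {..<2 * ?k}"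
  proof
    assume "z \<in> (!) ds ` {..<2 * ?k}"
    then obtain i where i: "i < 2 * ?k" "z = ds ! i" by auto
    then have "i < length ds" using k g ds(2) by linarith
    then show False using i ds(3) az(2) nth_mem by metis
  qed
  have "positive_on n ?A (insert a (insert z ((!) ds ` {..<2 * ?k}))) (Suc ?k)"
  proof (rule positive_on_pendant[OF adj_matrix_sym[OF sg]])
    show "?A $$ (a, a) = 0" "?A $$ (z, z) = 0" "?A $$ (z, a) \<noteq> 0"
      using zn za adj_matrix_nonzero_iff[OF sg] adj_matrix_diag[OF sg] by auto
    show "a < n" "z < n" "a \<noteq> z" using zn az by auto
    show "?A $$ (z, b) = 0" if "b \<in> (!) ds ` {..<2 * ?k}" "b < n" for b
      using that nonadj k adj_matrix_nonzero_iff[OF sg zn(1) that(2)] by auto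
    show "positive_on n ?A ((!) ds ` {..<2 * ?k}) ?k"
      by (rule positive_on_shortest_cycle[OF sg ds(1,2)])
  qed (use aS zS in auto)
  then have "Suc ?k \<le> i_plus n E sg" by (rule positive_on_le_i_plus[OF sg])
  then show ?thesis by simp
qed

section \<open>Complete multipartite graphs\<close>

lemma squares_plus_signed_product_pos:
  fixes x y s :: real
  assumes "s = 1 \<or> s = -1" "x \<noteq> 0 \<or> y \<noteq> 0"
  shows "0 < x\<^sup>2 + y\<^sup>2 + s * x * y"
proof -
  have "0 < x\<^sup>2 + y\<^sup>2" using assms(2) by (simp add: sum_power2_gt_zero_iff)
  moreover have "x\<^sup>2 + y\<^sup>2 + s * x * y = (x\<^sup>2 + y\<^sup>2 + (x + s * y)\<^sup>2) / 2"
    using assms(1) by (auto simp: power2_eq_square field_simps)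
  ultimately show ?thesis by (simp only:) (simp add: add_pos_nonneg)
qed

text \<open>In an unbalanced triangle, free values \<open>p\<close> at \<open>a\<close> and
  \<open>q\<close> at \<open>b\<close> together with the value they induce at \<open>c\<close> give
  the definite form \<open>2 * (p\<^sup>2 + q\<^sup>2 - sg a b * p * q)\<close>, hence two positive
  eigenvalues.\<close>

lemma triangle_balanced:
  assumes sg: "signed_graph n E sg" and i: "i_plus n E sg \<le> 1"
    and E: "E a b" "E b c" "E a c"
  shows "sg a b * sg b c * sg a c = 1"
proof (rule ccontr)
  assume neg: "\<not> ?thesis"
  let ?A = "adj_matrix n E sg"
  note D = signed_graphD[OF sg]
  have lt: "a < n" "b < n" "c < n" using D(1)[OF E(1)] D(1)[OF E(2)] by auto
  have ne: "a \<noteq> b" "b \<noteq> c" "a \<noteq> c" using E D(3) by blast+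
  have unb: "sg b c * sg a c = - sg a b"
    using neg D(4)[OF E(1)] D(4)[OF E(2)] D(4)[OF E(3)] by auto
  note diag = adj_matrix_diag[OF sg] and add_single = adj_matrix_quad_form_add_single[OF sg]
  define L where "L x v = (if v = a then x 0 else 0) + (if v = b then x (1::nat) else 0)
    + (if v = c then sg a c * x 0 + sg b c * x 1 else 0)" for x :: "nat \<Rightarrow> real" and v
  have "positive_on n ?A UNIV 2"
  proof (rule positive_on_linear[of L])
    fix x :: "nat \<Rightarrow> real" assume "\<exists>i<2. x i \<noteq> 0"
    then have nz: "x 0 \<noteq> 0 \<or> x 1 \<noteq> 0" by (auto simp: less_2_cases_iff)
    define p q where "p = x 0" and "q = x 1"
    define r where "r = sg a c * p + sg b c * q"
    define y0 where "y0 v = 0 + (if v = a then p else 0)" for v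
    define y1 where "y1 v = y0 v + (if v = b then q else 0)" for v
    have L: "L x = (\<lambda>v. y1 v + (if v = c then r else 0))"
      by (auto simp: L_def p_def q_def r_def y0_def y1_def)
    have "quad_form n ?A y0 = 0"
      unfolding y0_def[abs_def] add_single[OF lt(1)] by (simp add: quad_form_def diag lt)
    moreover have "(\<Sum>v<n. ?A $$ (b, v) * y0 v) = sg b a * p"
      using lt D(2)[OF E(1)] by (simp add: y0_def if_distrib[of "\<lambda>z. _ * z"] adj_matrix_index cong: if_cong)
    ultimately have y1: "quad_form n ?A y1 = 2 * q * sg b a * p"
      unfolding y1_def[abs_def] add_single[OF lt(2)] by simp
    have "(\<Sum>v<n. ?A $$ (c, v) * y1 v) = (\<Sum>v<n. if v = a then sg c a * p else 0) + (\<Sum>v<n. if v = b then sg c b * q else 0)"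
      unfolding sum.distrib[symmetric] using lt E D(2) ne by (intro sum.cong) (auto simp: adj_matrix_index y0_def y1_def)
    also have "\<dots> = r" using lt D(5) E by (simp add: r_def)
    finally have "quad_form n ?A (L x) = 2 * q * sg b a * p + 2 * r * r"
      unfolding L add_single[OF lt(3)] by (simp add: y1 diag lt)
    also have "r * r = p\<^sup>2 + q\<^sup>2 + 2 * (sg b c * sg a c) * p * q"
      using D(4)[OF E(2)] D(4)[OF E(3)] by (auto simp: r_def power2_eq_square algebra_simps)
    then have "2 * q * sg b a * p + 2 * r * r = 2 * (p\<^sup>2 + q\<^sup>2 + (- sg a b) * p * q)"
      unfolding unb using D(5)[OF E(1)] by (simp add: algebra_simps)
    also have "\<dots> > 0"
      using squares_plus_signed_product_pos[of "- sg a b" p q] nz D(4)[OF E(1)]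
      by (auto simp: p_def q_def)
    finally show "0 < quad_form n ?A (L x)" .
  qed (auto simp: L_def algebra_simps)
  from positive_on_le_i_plus[OF sg this] i show False by simp
qed

text \<open>In an unbalanced induced quadrangle, let \<open>a\<close>, \<open>c\<close> take free
  values \<open>p\<close>, \<open>q\<close> and \<open>b\<close>, \<open>d\<close> the induced
  values \<open>r\<close>, \<open>s\<close>. With both diagonals absent the form is
  \<open>2 * r\<^sup>2 + 2 * s\<^sup>2\<close>, and unbalance cancels the mixed terms, leaving
  \<open>4 * (p\<^sup>2 + q\<^sup>2)\<close>.\<close>

lemma induced_quadrangle_balanced:
  assumes sg: "signed_graph n E sg" and i: "i_plus n E sg \<le> 1"
    and E: "E a b" "E b c" "E c d" "E a d" and nE: "\<not> E a c" "\<not> E b d" and ne: "a \<noteq> c" "b \<noteq> d"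
  shows "sg a b * sg b c * sg c d * sg a d = 1"
proof (rule ccontr)
  assume neg: "\<not> ?thesis"
  let ?A = "adj_matrix n E sg"
  note D = signed_graphD[OF sg]
  have lt: "a < n" "b < n" "c < n" "d < n" using D(1)[OF E(1)] D(1)[OF E(3)] by auto
  have ne': "a \<noteq> b" "b \<noteq> c" "c \<noteq> d" "a \<noteq> d" using E D(3) by blast+
  have unb: "sg a b * sg b c = - (sg c d * sg a d)"
    using neg D(4)[OF E(1)] D(4)[OF E(2)] D(4)[OF E(3)] D(4)[OF E(4)] by auto
  note diag = adj_matrix_diag[OF sg] and add_single = adj_matrix_quad_form_add_single[OF sg]
  define L where "L x v = (if v = a then x 0 else 0) + (if v = c then x (1::nat) else 0)
    + (if v = b then sg a b * x 0 + sg b c * x 1 else 0)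
    + (if v = d then sg a d * x 0 + sg c d * x 1 else 0)" for x :: "nat \<Rightarrow> real" and v
  have "positive_on n ?A UNIV 2"
  proof (rule positive_on_linear[of L])
    fix x :: "nat \<Rightarrow> real" assume "\<exists>i<2. x i \<noteq> 0"
    then have nz: "x 0 \<noteq> 0 \<or> x 1 \<noteq> 0" by (auto simp: less_2_cases_iff)
    define p q where "p = x 0" and "q = x 1"
    define r s where "r = sg a b * p + sg b c * q" and "s = sg a d * p + sg c d * q"
    define y0 where "y0 v = 0 + (if v = a then p else 0)" for v
    define y1 where "y1 v = y0 v + (if v = c then q else 0)" for v
    define y2 where "y2 v = y1 v + (if v = b then r else 0)" for v
    have L: "L x = (\<lambda>v. y2 v + (if v = d then s else 0))"
      by (auto simp: L_def p_def q_def r_def s_def y0_def y1_def y2_def)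
    have "quad_form n ?A y0 = 0"
      unfolding y0_def[abs_def] add_single[OF lt(1)] by (simp add: quad_form_def diag lt)
    moreover have "(\<Sum>v<n. ?A $$ (c, v) * y0 v) = 0"
      using lt nE(1) D(2)[of c a] by (auto simp: y0_def adj_matrix_index intro!: sum.neutral)
    ultimately have y1: "quad_form n ?A y1 = 0"
      unfolding y1_def[abs_def] add_single[OF lt(3)] by simp
    have "(\<Sum>v<n. ?A $$ (b, v) * y1 v) = (\<Sum>v<n. if v = a then sg b a * p else 0) + (\<Sum>v<n. if v = c then sg b c * q else 0)"
      unfolding sum.distrib[symmetric] using lt E D(2) ne by (intro sum.cong) (auto simp: adj_matrix_index y0_def y1_def)
    also have "\<dots> = r" using lt D(5) E by (simp add: r_def)
    finally have y2: "quad_form n ?A y2 = 2 * r * r"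
      unfolding y2_def[abs_def] add_single[OF lt(2)] by (simp add: y1 diag lt)
    have "(\<Sum>v<n. ?A $$ (d, v) * y2 v) = (\<Sum>v<n. if v = a then sg d a * p else 0) + (\<Sum>v<n. if v = c then sg d c * q else 0)"
      unfolding sum.distrib[symmetric] using lt E D(2) ne ne' nE by (intro sum.cong) (auto simp: adj_matrix_index y0_def y1_def y2_def)
    also have "\<dots> = s" using lt D(5) E by (simp add: s_def)
    finally have "quad_form n ?A (L x) = 2 * r * r + 2 * s * s"
      unfolding L add_single[OF lt(4)] by (simp add: y2 diag lt)
    also have "r * r = p\<^sup>2 + q\<^sup>2 + 2 * (sg a b * sg b c) * p * q"
      using D(4)[OF E(1)] D(4)[OF E(2)] by (auto simp: r_def power2_eq_square algebra_simps)
    moreover have "s * s = p\<^sup>2 + q\<^sup>2 + 2 * (sg c d * sg a d) * p * q"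
      using D(4)[OF E(3)] D(4)[OF E(4)] by (auto simp: s_def power2_eq_square algebra_simps)
    ultimately have "quad_form n ?A (L x) = 4 * (p\<^sup>2 + q\<^sup>2)"
      using unb by (simp add: algebra_simps)
    also have "\<dots> > 0" using nz sum_power2_gt_zero_iff[of p q] by (simp add: p_def q_def)
    finally show "0 < quad_form n ?A (L x)" .
  qed (auto simp: L_def algebra_simps)
  from positive_on_le_i_plus[OF sg this] i show False by simp
qed

text \<open>If \<open>z\<close> sees neither end, connectivity gives an edge from a neighbour of
  \<open>u\<close> or \<open>v\<close> to a vertex that sees neither: a pendant edge over the edge
  \<open>u v\<close>, hence two positive eigenvalues.\<close>

lemma edge_dominates:
  assumes sg: "signed_graph n E sg" and conn: "connected_graph n E" and i: "i_plus n E sg \<le> 1"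
    and E: "E u v" and z: "z < n"
  shows "E z u \<or> E z v"
proof (rule ccontr)
  assume nE: "\<not> ?thesis"
  note D = signed_graphD[OF sg]
  let ?A = "adj_matrix n E sg"
  let ?S = "{a. E a u \<or> E a v}"
  have uv: "u < n" "v < n" "u \<noteq> v" "E v u" using D[OF E] by auto
  obtain a b where ab: "a \<in> ?S" "b \<notin> ?S" "E a b"
    using connected_graph_exit_edge[OF conn, of u ?S z] E uv z nE by auto
  have lt: "a < n" "b < n" "a \<noteq> b" "E b a" using D[OF ab(3)] by auto
  have ne: "a \<noteq> u" "a \<noteq> v" "b \<noteq> u" "b \<noteq> v" using ab E uv D(2) by blast+
  note diag = adj_matrix_diag[OF sg]
  \<comment> \<open>The edge \<open>u v\<close> is itself pendant over the empty set.\<close>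
  have "positive_on n ?A (insert u (insert v {})) (Suc 0)"
    by (rule positive_on_pendant[OF adj_matrix_sym[OF sg]])
      (use uv diag adj_matrix_nonzero_iff[OF sg] positive_on_0 in auto)
  then have "positive_on n ?A (insert a (insert b {u, v})) (Suc (Suc 0))"
    by (rule positive_on_pendant[OF adj_matrix_sym[OF sg], rotated -1])
      (use uv ab lt ne diag adj_matrix_nonzero_iff[OF sg] in auto)
  from positive_on_le_i_plus[OF sg this] i show False by simp
qed

text \<open>Supplies the consecutive part labels that
  \<open>switching_equiv_complete_multipartite\<close> demands.\<close>

lemma finite_classes_labelling:
  fixes rep :: "nat \<Rightarrow> nat"
  shows "\<exists>(l::nat) part. part ` {0..<n} = {0..<l} \<and>
    (\<forall>i<n. \<forall>j<n. part i = part j \<longleftrightarrow> rep i = rep j)"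
proof -
  obtain h where h: "bij_betw h (rep ` {0..<n}) {0..<card (rep ` {0..<n})}"
    using ex_bij_betw_finite_nat[of "rep ` {0..<n}"] by auto
  show ?thesis
  proof (intro exI[of _ "h \<circ> rep"] exI conjI allI impI)
    show "(h \<circ> rep) ` {0..<n} = {0..<card (rep ` {0..<n})}"
      using h by (simp add: bij_betw_def image_comp)
    show "(h \<circ> rep) i = (h \<circ> rep) j \<longleftrightarrow> rep i = rep j" if "i < n" "j < n" for i j
      using h that by (auto simp: bij_betw_def dest: inj_onD)
  qed
qed

text \<open>Since every edge dominates, non-adjacency is transitive and its classes are the parts.
  The switching is read off walks from \<open>r\<close>; balanced triangles and induced quadrangles
  show that it makes every edge positive.\<close>

lemma i_plus_le_1_imp_complete_multipartite:
  assumes sg: "signed_graph n E sg" and conn: "connected_graph n E" and i: "i_plus n E sg \<le> 1"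
    and rs: "E r s"
  shows "switching_equiv_complete_multipartite n E sg"
proof -
  note D = signed_graphD[OF sg]
  note dom = edge_dominates[OF sg conn i]
  have rsn: "r < n" "s < n" "E s r" using D[OF rs] by auto
  \<comment> \<open>The least non-neighbour represents the class of \<open>i\<close>; it exists
    because \<open>i\<close> is not adjacent to itself.\<close>
  define rep where "rep i = (LEAST j. j < n \<and> \<not> E i j)" for i
  have rep: "rep i < n \<and> \<not> E i (rep i)" if "i < n" for i
    unfolding rep_def by (rule LeastI[of _ i]) (use that D(3) in blast)
  have rep_eq: "rep i = rep j \<longleftrightarrow> \<not> E i j" if ij: "i < n" "j < n" for i j
  proof
    assume eq: "rep i = rep j"
    show "\<not> E i j"
      using dom[of i j "rep i"] rep[OF ij(1)] rep[OF ij(2)] eq D(2) by metis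
  next
    assume nE: "\<not> E i j"
    \<comment> \<open>The edge from \<open>i\<close> to a neighbour \<open>l\<close> dominates
      \<open>j\<close>, so \<open>j\<close> sees \<open>l\<close> too; non-adjacent vertices have
      the same neighbours.\<close>
    have "E i l \<longleftrightarrow> E j l" if "l < n" for l
      using dom[of i l j] dom[of j l i] ij nE D(2)[of i j] D(2)[of j i] D(2)[of l j] D(2)[of l i] by blast
    then have "(\<lambda>l. l < n \<and> \<not> E i l) = (\<lambda>l. l < n \<and> \<not> E j l)" by auto
    then show "rep i = rep j" by (simp add: rep_def)
  qed
  obtain l part where part: "part ` {0..<n} = {0..<l::nat}"
    "\<forall>i<n. \<forall>j<n. part i = part j \<longleftrightarrow> rep i = rep j"
    using finite_classes_labelling[of n rep] by blast
  have E_part: "E i j \<longleftrightarrow> part i \<noteq> part j" if "i < n" "j < n" for i j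
    using that part(2) rep_eq by simp
  have "part r \<in> {0..<l}" "part s \<in> {0..<l}" "part r \<noteq> part s"
    using part(1) rsn rs E_part by auto
  then have l: "l \<ge> 2" by auto
  \<comment> \<open>\<open>\<theta> i\<close> is the sign of a walk from \<open>r\<close> to
    \<open>i\<close>: the edge if there is one, otherwise the walk through \<open>s\<close>; in
    particular \<open>\<theta> r = 1\<close>.\<close>
  define \<theta> where "\<theta> i = (if E r i then sg r i else sg r s * sg s i)" for i
  have adj_s: "E s j" if "j < n" "\<not> E r j" for j
    using dom[OF rs, of j] that D(2) by blast
  have one: "\<theta> j = 1 \<or> \<theta> j = -1" if "j < n" for j
    using that adj_s[of j] D(4)[of r j] D(4)[OF rs] D(4)[of s j] by (auto simp: \<theta>_def)
  have sq: "sg x y * sg x y = 1" if "E x y" for x y using D(4)[OF that] by auto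
  have tri: "sg x y * sg y z = sg x z" if "E x y" "E y z" "E x z" for x y z
    using triangle_balanced[OF sg i that] D(4)[OF that(1)] D(4)[OF that(2)] D(4)[OF that(3)] by auto
  \<comment> \<open>The edge \<open>x y\<close> dominates \<open>r\<close>, and the edge
    \<open>r s\<close> dominates \<open>x\<close>; so the claim compares the walk
    \<open>r s x y\<close> with the edge \<open>r y\<close>.\<close>
  have main: "\<theta> x * sg x y * \<theta> y = 1" if xy: "E x y" "\<not> E r x" for x y
  proof -
    have n: "x < n" "y < n" using D(1)[OF xy(1)] by auto
    have ry: "E r y" using dom[of x y r] xy rsn D(2) by blast
    have sx: "E s x" using adj_s n xy by blast
    have "sg r s * sg s x * sg x y = sg r y"
    proof (cases "E s y")
      case True
      then show ?thesis using tri[OF sx xy(1) True] tri[OF rs True ry] by (simp only: mult.assoc)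
    next
      case False
      show ?thesis
      \<comment> \<open>In these cases the walk backtracks; otherwise it closes up to an induced
        quadrangle.\<close>
      proof (cases "r = x \<or> s = y")
        case True
        then show ?thesis
        proof
          assume "r = x"
          then show ?thesis using sq[OF rs] D(5)[OF rs] by simp
        next
          assume "s = y"
          then show ?thesis using sq[OF sx] D(5)[OF sx] by (simp add: mult.assoc)
        qed
      next
        case neq: False
        have "sg r s * sg s x * sg x y * sg r y = 1"
          using induced_quadrangle_balanced[OF sg i rs sx xy(1) ry] xy(2) False neq by blast
        then show ?thesis using D(4)[OF ry] by auto
      qed
    qed
    then show ?thesis using xy ry sq[OF ry] by (simp add: \<theta>_def)
  qed
  have "\<theta> x * sg x y * \<theta> y = 1" if xy: "E x y" for x y
  proof -
    consider "\<not> E r x" | "\<not> E r y" | "E r x" "E r y" by blast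
    then show ?thesis
    proof cases
      case 1
      then show ?thesis using main xy by blast
    next
      case 2
      then show ?thesis using main[of y x] xy D(2)[OF xy] D(5)[OF xy] by (simp add: mult_ac)
    next
      case 3
      then show ?thesis using tri[OF 3(1) xy 3(2)] sq[OF 3(2)] by (simp add: \<theta>_def)
    qed
  qed
  then show ?thesis
    unfolding switching_equiv_complete_multipartite_def using l part(1) E_part one by blast
qed

text \<open>After switching, the form is the square of the total sum minus the squares of the sums
  over the parts; it is nonpositive wherever the single functional with coefficients
  \<open>\<theta>\<close> vanishes.\<close>

lemma complete_multipartite_i_plus_le_1:
  assumes sg: "signed_graph n E sg" and K: "switching_equiv_complete_multipartite n E sg"
  shows "i_plus n E sg \<le> 1"
proof -
  let ?A = "adj_matrix n E sg"
  obtain l :: nat and part \<theta> where part: "part ` {0..<n} = {0..<l}"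
    "\<forall>i<n. \<forall>j<n. E i j \<longleftrightarrow> part i \<noteq> part j"
    and one: "\<forall>i<n. \<theta> i = (1::real) \<or> \<theta> i = -1"
    and \<theta>: "\<forall>i j. E i j \<longrightarrow> \<theta> i * sg i j * \<theta> j = 1"
    using K unfolding switching_equiv_complete_multipartite_def by blast
  have A: "?A $$ (i, j) = \<theta> i * \<theta> j * (if part i = part j then 0 else 1)" if "i < n" "j < n" for i j
  proof -
    have "\<theta> i = 1 \<or> \<theta> i = -1" "\<theta> j = 1 \<or> \<theta> j = -1" "E i j \<longleftrightarrow> part i \<noteq> part j"
      using that one part(2) by auto
    moreover have "\<theta> i * sg i j * \<theta> j = 1" if "E i j" using \<theta> that by blast
    ultimately show ?thesis using that by (auto simp: adj_matrix_index)
  qed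
  have "pos_inertia ?A \<le> 1"
  proof (rule pos_inertia_upper_bound[OF adj_matrix_carrier adj_matrix_transpose[OF sg], of 1 "\<lambda>_. \<theta>"])
    fix x assume "\<forall>i<1::nat. (\<Sum>a<n. \<theta> a * x a) = 0"
    then have zero: "(\<Sum>a<n. \<theta> a * x a) = 0" by simp
    define y where "y a = \<theta> a * x a" for a
    have pl: "part i < l" if "i < n" for i using part(1) that by (metis atLeastLessThan_iff imageI zero_le)
    \<comment> \<open>The indicator of \<open>part i = part j\<close> is written as a sum over the
      parts \<open>q\<close>, so that the double sum factors into squares.\<close>
    have "quad_form n ?A x = (\<Sum>i<n. \<Sum>j<n. y i * y j - (\<Sum>q<l. (if part i = q then y i else 0) * (if part j = q then y j else 0)))"
      unfolding quad_form_def
    proof (intro sum.cong refl)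
      fix i j assume "i \<in> {..<n}" "j \<in> {..<n}"
      then have ij: "i < n" "j < n" by auto
      have "(\<Sum>q<l. (if part i = q then y i else 0) * (if part j = q then y j else 0)) =
        (\<Sum>q<l. if q = part i then y i * (if part j = part i then y j else 0) else 0)"
        by (intro sum.cong) auto
      also have "\<dots> = (if part j = part i then y i * y j else 0)" using pl[OF ij(1)] by simp
      finally show "?A $$ (i, j) * x i * x j =
          y i * y j - (\<Sum>q<l. (if part i = q then y i else 0) * (if part j = q then y j else 0))"
        by (simp add: A[OF ij] y_def)
    qed
    also have "\<dots> = (\<Sum>i<n. y i) * (\<Sum>j<n. y j) -
      (\<Sum>i<n. \<Sum>j<n. \<Sum>q<l. (if part i = q then y i else 0) * (if part j = q then y j else 0))"
      by (simp add: sum_subtractf sum_product)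
    also have "(\<Sum>i<n. y i) = 0" using zero by (simp add: y_def)
    also have "(\<Sum>i<n. \<Sum>j<n. \<Sum>q<l. (if part i = q then y i else 0) * (if part j = q then y j else 0))
      = (\<Sum>q<l. (\<Sum>i<n. if part i = q then y i else 0)\<^sup>2)"
    proof -
      have "(\<Sum>i<n. \<Sum>j<n. \<Sum>q<l. (if part i = q then y i else 0) * (if part j = q then y j else 0))
        = (\<Sum>i<n. \<Sum>q<l. \<Sum>j<n. (if part i = q then y i else 0) * (if part j = q then y j else 0))"
        by (intro sum.cong refl sum.swap)
      also have "\<dots> = (\<Sum>q<l. \<Sum>i<n. \<Sum>j<n. (if part i = q then y i else 0) * (if part j = q then y j else 0))"
        by (rule sum.swap)
      finally show ?thesis by (simp only: power2_eq_square sum_product)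
    qed
    finally show "quad_form n ?A x \<le> 0" by (simp add: sum_nonneg)
  qed
  then show ?thesis by (simp add: i_plus_def)
qed

section \<open>Cycle graphs\<close>

lemma cycle_graph_edge_iff:
  assumes "graph_is_cycle n E cs" "i < length cs" "j < length cs"
  shows "E (cs ! i) (cs ! j) \<longleftrightarrow> j = (i + 1) mod length cs \<or> i = (j + 1) mod length cs"
proof -
  let ?g = "length cs"
  have d: "distinct cs" and g: "0 < ?g" using assms(1) by (auto simp: graph_is_cycle_def is_cycle_def)
  have eq: "cs ! a = cs ! b \<longleftrightarrow> a = b" if "a < ?g" "b < ?g" for a b
    using d that by (simp add: nth_eq_iff_index_eq)
  have m: "(a + 1) mod ?g < ?g" for a using g by simp
  have "E (cs ! i) (cs ! j) \<longleftrightarrow> (\<exists>l<?g. (cs ! i = cs ! l \<and> cs ! j = cs ! ((l + 1) mod ?g)) \<or>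
     (cs ! j = cs ! l \<and> cs ! i = cs ! ((l + 1) mod ?g)))"
    using assms(1) unfolding graph_is_cycle_def by blast
  also have "\<dots> \<longleftrightarrow> j = (i + 1) mod ?g \<or> i = (j + 1) mod ?g"
    using assms(2,3) m by (auto simp: eq simp del: One_nat_def)
  finally show ?thesis .
qed

text \<open>The adjacency form runs over ordered pairs, so each cycle edge counts twice.\<close>

lemma cycle_graph_quad_form:
  assumes sg: "signed_graph n E sg" and gc: "graph_is_cycle n E cs"
  shows "quad_form n (adj_matrix n E sg) x = 2 * (\<Sum>i<length cs.
    sg (cs ! i) (cs ! ((i + 1) mod length cs)) * x (cs ! i) * x (cs ! ((i + 1) mod length cs)))"
proof -
  let ?g = "length cs" and ?A = "adj_matrix n E sg"
  define nx where "nx i = (i + 1) mod ?g" for i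
  have g: "3 \<le> ?g" and d: "distinct cs" and set: "set cs = {..<n}"
    using gc by (auto simp: graph_is_cycle_def is_cycle_def)
  have nx: "nx i < ?g" for i using g unfolding nx_def by (intro mod_less_divisor) linarith
  have nx': "nx i = (if Suc i = ?g then 0 else Suc i)" if "i < ?g" for i
    using that by (auto simp: nx_def)
  define T where "T i = sg (cs ! i) (cs ! nx i) * x (cs ! i) * x (cs ! nx i)" for i
  have bij: "bij_betw ((!) cs) {..<?g} {..<n}"
    using d set by (metis bij_betw_nth)
  have lt: "cs ! i < n" if "i < ?g" for i using set that by (metis lessThan_iff nth_mem)
  have entry: "?A $$ (cs ! i, cs ! j) * x (cs ! i) * x (cs ! j) =
      (if j = nx i then T i else 0) + (if i = nx j then T j else 0)" if ij: "i < ?g" "j < ?g" for i j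
  proof -
    have E: "E (cs ! i) (cs ! j) \<longleftrightarrow> j = nx i \<or> i = nx j"
      using cycle_graph_edge_iff[OF gc ij] by (simp add: nx_def)
    \<comment> \<open>This is where length at least 3 matters: no edge is traversed in both
      directions by the cycle.\<close>
    have excl: "\<not> (j = nx i \<and> i = nx j)" using ij g by (auto simp: nx' split: if_splits)
    have A: "?A $$ (cs ! i, cs ! j) = (if E (cs ! i) (cs ! j) then sg (cs ! i) (cs ! j) else 0)"
      using lt ij by (simp add: adj_matrix_index)
    consider "j = nx i" "i \<noteq> nx j" | "i = nx j" "j \<noteq> nx i" | "j \<noteq> nx i" "i \<noteq> nx j"
      using excl by blast
    then show ?thesis
    proof cases
      case 1
      then show ?thesis using E A by (simp add: T_def)
    next
      case 2
      then have "E (cs ! i) (cs ! j)" using E by simp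
      then have "sg (cs ! j) (cs ! i) = sg (cs ! i) (cs ! j)" using signed_graphD(5)[OF sg] by blast
      then show ?thesis using 2 E A by (simp add: T_def mult_ac)
    next
      case 3
      then show ?thesis using E A by simp
    qed
  qed
  have "quad_form n ?A x = (\<Sum>i<?g. \<Sum>j<?g. ?A $$ (cs ! i, cs ! j) * x (cs ! i) * x (cs ! j))"
    unfolding quad_form_def by (simp only: sum.reindex_bij_betw[OF bij, symmetric])
  also have "\<dots> = (\<Sum>i<?g. \<Sum>j<?g. (if j = nx i then T i else 0) + (if i = nx j then T j else 0))"
    by (intro sum.cong refl) (simp add: entry)
  also have "\<dots> = (\<Sum>i<?g. \<Sum>j<?g. if j = nx i then T i else 0) + (\<Sum>i<?g. \<Sum>j<?g. if i = nx j then T j else 0)"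
    by (simp add: sum.distrib)
  also have "(\<Sum>i<?g. \<Sum>j<?g. if i = nx j then T j else 0) = (\<Sum>j<?g. \<Sum>i<?g. if i = nx j then T j else 0)"
    by (rule sum.swap)
  also have "(\<Sum>i<?g. \<Sum>j<?g. if j = nx i then T i else 0) + \<dots> = 2 * (\<Sum>i<?g. T i)"
    using nx by simp
  finally show ?thesis by (simp add: T_def nx_def)
qed

lemma cycle_sign_cases:
  assumes sg: "signed_graph n E sg" and cyc: "is_cycle n E cs"
  shows "cycle_sign sg cs = 1 \<or> cycle_sign sg cs = -1"
proof -
  have pm: "(\<Prod>i<m. f i) = 1 \<or> (\<Prod>i<m. f i) = -1" if "\<And>i. i < m \<Longrightarrow> f i = 1 \<or> f i = -1"
    for f :: "nat \<Rightarrow> real" and m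
    using that
  proof (induction m)
    case (Suc m)
    have "(\<Prod>i<m. f i) = 1 \<or> (\<Prod>i<m. f i) = -1" by (rule Suc.IH) (simp add: Suc.prems)
    moreover have "f m = 1 \<or> f m = -1" by (simp add: Suc.prems)
    ultimately show ?case by auto
  qed simp
  show ?thesis unfolding cycle_sign_def
    using cyc by (intro pm signed_graphD(4)[OF sg]) (simp add: is_cycle_def)
qed

text \<open>Switching along the path obtained by deleting the last edge makes all edges but that one
  positive; the remaining edge then carries the sign of the cycle.\<close>

lemma cycle_graph_quad_form_switched:
  assumes sg: "signed_graph n E sg" and gc: "graph_is_cycle n E cs"
  shows "\<exists>\<theta>::nat \<Rightarrow> real. (\<forall>i<length cs. \<theta> i * \<theta> i = 1) \<and>
    (\<forall>x. quad_form n (adj_matrix n E sg) x =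
      2 * (\<Sum>i<length cs - 1. (\<theta> i * x (cs ! i)) * (\<theta> (Suc i) * x (cs ! Suc i))) +
      2 * cycle_sign sg cs * (\<theta> (length cs - 1) * x (cs ! (length cs - 1))) * (\<theta> 0 * x (cs ! 0)))"
proof -
  let ?g = "length cs"
  have cyc: "is_cycle n E cs" and g: "3 \<le> ?g" using gc by (auto simp: graph_is_cycle_def is_cycle_def)
  define s where "s i = sg (cs ! i) (cs ! ((i + 1) mod ?g))" for i
  define \<theta> where "\<theta> i = (\<Prod>l<i. s l)" for i
  have s: "s i * s i = 1" if "i < ?g" for i
  proof -
    have "E (cs ! i) (cs ! ((i + 1) mod ?g))" using cyc that by (simp add: is_cycle_def)
    from signed_graphD(4)[OF sg this] show ?thesis by (auto simp: s_def)
  qed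
  have \<theta>: "\<theta> i * \<theta> i = 1" if "i < ?g" for i
    unfolding \<theta>_def prod.distrib[symmetric] using that s by (intro prod.neutral) auto
  have step: "s i = \<theta> i * \<theta> (Suc i)" if "i < ?g" for i
    using \<theta>[OF that] by (simp add: \<theta>_def mult.assoc[symmetric])
  obtain g' where g': "?g = Suc g'" using g by (cases ?g) auto
  have sign: "cycle_sign sg cs = \<theta> g' * s g'"
    unfolding cycle_sign_def g' \<theta>_def s_def by simp
  have "quad_form n (adj_matrix n E sg) x =
      2 * (\<Sum>i<?g - 1. (\<theta> i * x (cs ! i)) * (\<theta> (Suc i) * x (cs ! Suc i))) +
      2 * cycle_sign sg cs * (\<theta> (?g - 1) * x (cs ! (?g - 1))) * (\<theta> 0 * x (cs ! 0))" for x
  proof -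
    have "quad_form n (adj_matrix n E sg) x =
        2 * (\<Sum>i<Suc g'. s i * x (cs ! i) * x (cs ! ((i + 1) mod Suc g')))"
      unfolding cycle_graph_quad_form[OF sg gc] s_def g' ..
    also have "(\<Sum>i<Suc g'. s i * x (cs ! i) * x (cs ! ((i + 1) mod Suc g'))) =
        (\<Sum>i<g'. s i * x (cs ! i) * x (cs ! Suc i)) + s g' * x (cs ! g') * x (cs ! 0)"
      by simp
    also have "(\<Sum>i<g'. s i * x (cs ! i) * x (cs ! Suc i)) =
        (\<Sum>i<g'. (\<theta> i * x (cs ! i)) * (\<theta> (Suc i) * x (cs ! Suc i)))"
      using g' by (intro sum.cong refl) (simp add: step mult_ac)
    also have "s g' * x (cs ! g') * x (cs ! 0) =
        cycle_sign sg cs * (\<theta> g' * x (cs ! g')) * (\<theta> 0 * x (cs ! 0))"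
    proof -
      have "cycle_sign sg cs * \<theta> g' = (\<theta> g' * \<theta> g') * s g'" by (simp add: sign mult_ac)
      also have "\<dots> = s g'" using \<theta>[of g'] g' by simp
      finally have "s g' = cycle_sign sg cs * \<theta> g'" ..
      then show ?thesis by (simp add: \<theta>_def[of 0] mult.assoc)
    qed
    finally show ?thesis using g' by (simp add: algebra_simps)
  qed
  then show ?thesis using \<theta> by blast
qed

text \<open>Grouping the path edges around the odd positions shows that each odd value enters
  linearly, multiplied by the sum of its even neighbours.\<close>

lemma sum_consecutive_products_even:
  fixes y :: "nat \<Rightarrow> real"
  shows "(\<Sum>i<2 * k. y i * y (Suc i)) = (\<Sum>j<k. y (2 * j + 1) * (y (2 * j) + y (2 * j + 2)))"
  by (induction k) (auto simp: algebra_simps)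

lemma alternating_of_consecutive_sums_zero:
  fixes c :: "nat \<Rightarrow> real"
  assumes "\<And>j. j < k \<Longrightarrow> c j + c (Suc j) = 0" "j \<le> k"
  shows "c j = (-1) ^ j * c 0"
  using assms(2)
proof (induction j)
  case (Suc j)
  then show ?case using assms(1)[of j] by simp
qed simp

lemma alternating_sum_telescope:
  fixes c :: "nat \<Rightarrow> real"
  shows "(\<Sum>j<k. (-1) ^ j * (c j + c (Suc j))) = c 0 - (-1) ^ k * c k"
  by (induction k) (auto simp: algebra_simps)

text \<open>On the common kernel of the forms \<open>y\<^sub>2\<^sub>j + y\<^sub>2\<^sub>j\<^sub>+\<^sub>2\<close> only the closing edge of the cycle
  contributes, and there \<open>y\<^sub>2\<^sub>k = (-1)\<^sup>k y\<^sub>0\<close>.\<close>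

lemma cycle_graph_i_plus_le:
  assumes sg: "signed_graph n E sg" and gc: "graph_is_cycle n E cs"
    and sign: "cycle_sign sg cs = - ((-1) ^ ((length cs - 1) div 2))"
  shows "i_plus n E sg \<le> (length cs - 1) div 2"
proof -
  let ?g = "length cs" and ?A = "adj_matrix n E sg"
  define k where "k = (?g - 1) div 2"
  have g: "3 \<le> ?g" and set: "set cs = {..<n}"
    using gc by (auto simp: graph_is_cycle_def is_cycle_def)
  have gk: "?g = 2 * k + 1 \<or> ?g = 2 * k + 2" using g by (auto simp: k_def)
  have lt: "cs ! i < n" if "i < ?g" for i using set that by (metis lessThan_iff nth_mem)
  obtain \<theta> :: "nat \<Rightarrow> real" where q: "\<forall>x. quad_form n ?A x =
      2 * (\<Sum>i<?g - 1. (\<theta> i * x (cs ! i)) * (\<theta> (Suc i) * x (cs ! Suc i))) +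
      2 * cycle_sign sg cs * (\<theta> (?g - 1) * x (cs ! (?g - 1))) * (\<theta> 0 * x (cs ! 0))"
    using cycle_graph_quad_form_switched[OF sg gc] by blast
  \<comment> \<open>\<open>f i\<close> applied to \<open>x\<close> gives the sum of the switched
    values at positions \<open>2 * i\<close> and \<open>2 * i + 2\<close>.\<close>
  define f where "f i a = (if a = cs ! (2 * i) then \<theta> (2 * i) else 0) +
    (if a = cs ! (2 * i + 2) then \<theta> (2 * i + 2) else 0)" for i a
  have "pos_inertia ?A \<le> k"
  proof (rule pos_inertia_upper_bound[OF adj_matrix_carrier adj_matrix_transpose[OF sg], of k f])
    fix x assume zero: "\<forall>i<k. (\<Sum>a<n. f i a * x a) = 0"
    define y where "y i = \<theta> i * x (cs ! i)" for i
    have kern: "y (2 * j) + y (2 * Suc j) = 0" if "j < k" for j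
    proof -
      have "(\<Sum>a<n. f j a * x a) = (\<Sum>a<n. if a = cs ! (2 * j) then \<theta> (2 * j) * x a else 0) +
          (\<Sum>a<n. if a = cs ! (2 * j + 2) then \<theta> (2 * j + 2) * x a else 0)"
        unfolding sum.distrib[symmetric] by (intro sum.cong refl) (auto simp: f_def algebra_simps)
      also have "\<dots> = y (2 * j) + y (2 * Suc j)"
        using lt[of "2 * j"] lt[of "2 * j + 2"] that gk by (auto simp: y_def)
      finally show ?thesis using zero that by simp
    qed
    have y2k: "y (2 * k) = (-1) ^ k * y 0"
      using alternating_of_consecutive_sums_zero[of k "\<lambda>j. y (2 * j)" k] kern by simp
    have path: "(\<Sum>i<2 * k. y i * y (Suc i)) = 0"
      unfolding sum_consecutive_products_even using kern by (intro sum.neutral) auto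
    have pp: "(-1) ^ k * (-1) ^ k = (1::real)" by (simp add: power_mult_distrib[symmetric])
    have sk: "cycle_sign sg cs = - ((-1) ^ k)" using sign by (simp add: k_def)
    have Q: "quad_form n ?A x = 2 * (\<Sum>i<?g - 1. y i * y (Suc i)) - 2 * (-1) ^ k * y (?g - 1) * y 0"
      using q[rule_format, of x] by (simp add: y_def sk)
    \<comment> \<open>For odd length the closing edge joins positions \<open>2 * k\<close> and 0 and
      contributes \<open>- 2 * (y 0)\<^sup>2\<close>. For even length position
      \<open>2 * k + 1\<close> remains, and its two edges cancel.\<close>
    from gk show "quad_form n ?A x \<le> 0"
    proof
      assume "?g = 2 * k + 1"
      then have "quad_form n ?A x = - 2 * ((-1) ^ k * (-1) ^ k) * (y 0 * y 0)"
        unfolding Q using path by (simp add: y2k)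
      then show ?thesis by (simp add: pp)
    next
      assume "?g = 2 * k + 2"
      then have "quad_form n ?A x = 2 * (y (2 * k) * y (Suc (2 * k))) - 2 * (-1) ^ k * y (Suc (2 * k)) * y 0"
        unfolding Q using path by simp
      then show ?thesis by (simp add: y2k)
    qed
  qed
  then show ?thesis by (simp add: i_plus_def k_def)
qed

text \<open>The values at even positions are free. Those at odd positions are chosen to complete the squares
  of \<open>y\<^sub>2\<^sub>j + y\<^sub>2\<^sub>j\<^sub>+\<^sub>2\<close>; for odd length the term \<open>(-1)\<^sup>j y\<^sub>0\<close> is added, which by telescoping turns the
  closing edge into the square of \<open>y\<^sub>0\<close>.\<close>

lemma cycle_graph_i_plus_gt:
  assumes sg: "signed_graph n E sg" and gc: "graph_is_cycle n E cs"
    and sign: "cycle_sign sg cs = (-1) ^ ((length cs - 1) div 2)"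
  shows "(length cs - 1) div 2 < i_plus n E sg"
proof -
  let ?g = "length cs" and ?A = "adj_matrix n E sg"
  define k where "k = (?g - 1) div 2"
  have g: "3 \<le> ?g" and d: "distinct cs"
    using gc by (auto simp: graph_is_cycle_def is_cycle_def)
  have gk: "?g = 2 * k + 1 \<or> ?g = 2 * k + 2" using g by (auto simp: k_def)
  obtain \<theta> :: "nat \<Rightarrow> real" where \<theta>: "\<forall>i<?g. \<theta> i * \<theta> i = 1" and q: "\<forall>x. quad_form n ?A x =
      2 * (\<Sum>i<?g - 1. (\<theta> i * x (cs ! i)) * (\<theta> (Suc i) * x (cs ! Suc i))) +
      2 * cycle_sign sg cs * (\<theta> (?g - 1) * x (cs ! (?g - 1))) * (\<theta> 0 * x (cs ! 0))"
    using cycle_graph_quad_form_switched[OF sg gc] by blast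
  define \<epsilon> :: real where "\<epsilon> = (if ?g = 2 * k + 1 then 1 else 0)"
  \<comment> \<open>The last case serves position \<open>2 * k + 1\<close>, present only for even
    length; its value makes its two edges contribute a square.\<close>
  define Y where "Y c m = (if even m then c (m div 2)
      else if m div 2 < k then c (m div 2) + c (Suc (m div 2)) + \<epsilon> * (-1) ^ (m div 2) * c 0
      else c k + (-1) ^ k * c 0)" for c :: "nat \<Rightarrow> real" and m :: nat
  define idx where "idx a = (THE i. i < ?g \<and> cs ! i = a)" for a
  have idx: "idx (cs ! i) = i" if "i < ?g" for i
    unfolding idx_def using d that by (intro the_equality) (auto simp: nth_eq_iff_index_eq)
  \<comment> \<open>The factor \<open>\<theta>\<close> undoes the switching because it squares to
    1.\<close>
  define L where "L c a = \<theta> (idx a) * Y c (idx a)" for c a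
  have L: "\<theta> i * L c (cs ! i) = Y c i" if "i < ?g" for c i
  proof -
    have "\<theta> i * L c (cs ! i) = (\<theta> i * \<theta> i) * Y c i" by (simp add: L_def idx[OF that])
    then show ?thesis using \<theta> that by simp
  qed
  have "positive_on n ?A UNIV (Suc k)"
  proof (rule positive_on_linear[of L])
    fix c :: "nat \<Rightarrow> real" assume nz: "\<exists>i<Suc k. c i \<noteq> 0"
    define e where "e j = c j + c (Suc j)" for j
    \<comment> \<open>Vanishing consecutive sums make \<open>c\<close> alternate in sign, so with
      \<open>c 0 = 0\<close> it would vanish entirely.\<close>
    have nz': "c 0 \<noteq> 0 \<or> (\<exists>j<k. e j \<noteq> 0)"
    proof (rule ccontr)
      assume "\<not> ?thesis"
      then have "c 0 = 0" "\<And>j. j < k \<Longrightarrow> c j + c (Suc j) = 0" by (auto simp: e_def)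
      then have "c j = 0" if "j \<le> k" for j
        using alternating_of_consecutive_sums_zero[of k c j] that by simp
      then show False using nz by (auto simp: less_Suc_eq_le)
    qed
    have "(\<Sum>i<?g - 1. (\<theta> i * L c (cs ! i)) * (\<theta> (Suc i) * L c (cs ! Suc i))) =
        (\<Sum>i<?g - 1. Y c i * Y c (Suc i))"
      by (intro sum.cong refl) (use L in auto)
    moreover have "\<theta> (?g - 1) * L c (cs ! (?g - 1)) = Y c (?g - 1)" "\<theta> 0 * L c (cs ! 0) = Y c 0"
      by (intro L; use g in linarith)+
    moreover have "cycle_sign sg cs = (-1) ^ k" using sign by (simp add: k_def)
    ultimately have Q: "quad_form n ?A (L c) = 2 * (\<Sum>i<?g - 1. Y c i * Y c (Suc i)) + 2 * (-1) ^ k * Y c (?g - 1) * Y c 0"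
      using q[rule_format, of "L c"] by (simp only:)
    have Y0: "Y c (2 * j) = c j" for j by (simp add: Y_def)
    have Y1: "Y c (2 * j + 1) = e j + \<epsilon> * (-1) ^ j * c 0" if "j < k" for j
      using that by (simp add: Y_def e_def)
    have "(\<Sum>i<2 * k. Y c i * Y c (Suc i)) = (\<Sum>j<k. (e j)\<^sup>2 + \<epsilon> * c 0 * ((-1) ^ j * e j))"
      unfolding sum_consecutive_products_even
    proof (intro sum.cong refl)
      fix j assume "j \<in> {..<k}"
      then have "Y c (2 * j + 1) = e j + \<epsilon> * (-1) ^ j * c 0" using Y1 by simp
      moreover have "Y c (2 * j) + Y c (2 * j + 2) = e j" using Y0[of j] Y0[of "Suc j"] by (simp add: e_def)
      ultimately show "Y c (2 * j + 1) * (Y c (2 * j) + Y c (2 * j + 2)) = (e j)\<^sup>2 + \<epsilon> * c 0 * ((-1) ^ j * e j)"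
        by (simp add: power2_eq_square algebra_simps)
    qed
    also have "\<dots> = (\<Sum>j<k. (e j)\<^sup>2) + \<epsilon> * c 0 * (c 0 - (-1) ^ k * c k)"
      by (simp add: sum.distrib sum_distrib_left[symmetric] e_def alternating_sum_telescope)
    finally have path: "(\<Sum>i<2 * k. Y c i * Y c (Suc i)) = (\<Sum>j<k. (e j)\<^sup>2) + \<epsilon> * c 0 * (c 0 - (-1) ^ k * c k)" .
    have sum_e: "0 \<le> (\<Sum>j<k. (e j)\<^sup>2)" by (simp add: sum_nonneg)
    have sum_e_pos: "0 < (\<Sum>j<k. (e j)\<^sup>2)" if ex: "\<exists>j<k. e j \<noteq> 0"
    proof -
      obtain j where "j < k" "e j \<noteq> 0" using ex by blast
      then show ?thesis by (intro sum_pos2[of _ j]) auto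
    qed
    from gk show "0 < quad_form n ?A (L c)"
    proof
      assume odd: "?g = 2 * k + 1"
      then have "quad_form n ?A (L c) = 2 * (\<Sum>j<k. (e j)\<^sup>2) + 2 * (c 0)\<^sup>2"
        unfolding Q using path Y0[of k] Y0[of 0] by (simp add: \<epsilon>_def power2_eq_square algebra_simps)
      moreover have "0 < (\<Sum>j<k. (e j)\<^sup>2) \<or> 0 < (c 0)\<^sup>2" using nz' sum_e_pos by auto
      moreover have "0 \<le> (c 0)\<^sup>2" by simp
      ultimately show ?thesis using sum_e by linarith
    next
      assume even: "?g = 2 * k + 2"
      have Yl: "Y c (Suc (2 * k)) = c k + (-1) ^ k * c 0" by (simp add: Y_def)
      have "quad_form n ?A (L c) = 2 * (\<Sum>j<k. (e j)\<^sup>2) + 2 * (c k + (-1) ^ k * c 0)\<^sup>2"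
        unfolding Q using even path Y0[of k] Y0[of 0] Yl by (simp add: \<epsilon>_def power2_eq_square algebra_simps)
      moreover have "0 < (\<Sum>j<k. (e j)\<^sup>2) \<or> 0 < (c k + (-1) ^ k * c 0)\<^sup>2"
      proof (cases "\<exists>j<k. e j \<noteq> 0")
        \<comment> \<open>Now \<open>c\<close> alternates, so the base of the last square is
          \<open>2 * c k\<close>, which is nonzero.\<close>
        case False
        then have "c k = (-1) ^ k * c 0" "c 0 \<noteq> 0"
          using alternating_of_consecutive_sums_zero[of k c k] nz' by (auto simp: e_def)
        then show ?thesis by simp
      qed (use sum_e_pos in blast)
      moreover have "0 \<le> (c k + (-1) ^ k * c 0)\<^sup>2" by simp
      ultimately show ?thesis using sum_e by linarith
    qed
  qed (auto simp: L_def Y_def algebra_simps)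
  from positive_on_le_i_plus[OF sg this] show ?thesis by (simp add: k_def)
qed

text \<open>Both ends of any edge lie on the spanning cycle, and the absence of chords makes it a
  cycle edge.\<close>

lemma spanning_shortest_cycle_is_graph:
  assumes sg: "signed_graph n E sg" and cyc: "is_cycle n E cs" and min: "length cs = girth n E"
    and span: "set cs = {0..<n}"
  shows "graph_is_cycle n E cs"
proof -
  let ?g = "length cs"
  have g: "3 \<le> ?g" using cyc by (simp add: is_cycle_def)
  have cyc_edge: "E (cs ! i) (cs ! ((i + 1) mod ?g))" if "i < ?g" for i
    using cyc that by (simp add: is_cycle_def)
  have ordered: "\<exists>i<?g. (u = cs ! i \<and> v = cs ! ((i + 1) mod ?g)) \<or> (v = cs ! i \<and> u = cs ! ((i + 1) mod ?g))"
    if E: "E u v" "u = cs ! a" "v = cs ! b" "a < b" "b < ?g" for u v a b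
  proof -
    have "b = Suc a \<or> (a = 0 \<and> b = ?g - 1)"
      using shortest_cycle_chordless[OF sg cyc min that(4,5)] E by simp
    then show ?thesis
    proof (elim disjE conjE)
      assume "b = Suc a"
      then show ?thesis using E by (intro exI[of _ a]) auto
    next
      assume "a = 0" "b = ?g - 1"
      then have "b + 1 = ?g" using g by linarith
      then show ?thesis using E \<open>a = 0\<close> by (intro exI[of _ b]) simp
    qed
  qed
  have "\<exists>i<?g. (u = cs ! i \<and> v = cs ! ((i + 1) mod ?g)) \<or> (v = cs ! i \<and> u = cs ! ((i + 1) mod ?g))"
    if E: "E u v" for u v
  proof -
    obtain a b where ab: "a < ?g" "b < ?g" "u = cs ! a" "v = cs ! b"
      using signed_graphD(1)[OF sg E] span by (metis atLeastLessThan_iff in_set_conv_nth zero_le)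
    have "a \<noteq> b" using ab signed_graphD(3)[OF sg E] by auto
    then consider "a < b" | "b < a" by linarith
    then show ?thesis
    proof cases
      case 1
      then show ?thesis using ordered[OF E] ab by blast
    next
      case 2
      then show ?thesis using ordered[OF signed_graphD(2)[OF sg E]] ab by blast
    qed
  qed
  moreover have "E u v" if "i < ?g"
    "(u = cs ! i \<and> v = cs ! ((i + 1) mod ?g)) \<or> (v = cs ! i \<and> u = cs ! ((i + 1) mod ?g))" for u v i
    using that cyc_edge[of i] signed_graphD(2)[OF sg] by blast
  ultimately show ?thesis unfolding graph_is_cycle_def using cyc span by blast
qed

section \<open>The inertia bound\<close>

lemma ceiling_half_minus_one:
  assumes "1 \<le> g"
  shows "\<lceil>real g / 2\<rceil> - 1 = int ((g - 1) div 2)"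
proof -
  have "\<lceil>real g / 2\<rceil> = int ((g - 1) div 2) + 1"
  proof (rule ceiling_unique)
    have "2 * ((g - 1) div 2) < g" "g \<le> 2 * ((g - 1) div 2) + 2" using assms by auto
    then have "2 * real ((g - 1) div 2) < real g" "real g \<le> 2 * real ((g - 1) div 2) + 2"
      by linarith+
    then show "of_int (int ((g - 1) div 2) + 1) - 1 < real g / 2"
      "real g / 2 \<le> of_int (int ((g - 1) div 2) + 1)" by simp_all
  qed
  then show ?thesis by simp
qed

text \<open>Merges the two balance conditions into one sign equation: \<open>(g - 1) div 2\<close>
  is even exactly when \<open>g\<close> is 1 or 2 modulo 4.\<close>

lemma balance_residue_iff:
  fixes \<sigma> :: real
  assumes "3 \<le> g" "\<sigma> = 1 \<or> \<sigma> = -1"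
  shows "(\<sigma> = 1 \<and> (g mod 4 = 0 \<or> g mod 4 = 3)) \<or> (\<sigma> \<noteq> 1 \<and> (g mod 4 = 1 \<or> g mod 4 = 2))
    \<longleftrightarrow> \<sigma> = - ((-1) ^ ((g - 1) div 2))"
proof -
  have "even ((g - 1) div 2) \<longleftrightarrow> g mod 4 = 1 \<or> g mod 4 = 2" using assms(1) by presburger
  moreover have "g mod 4 = 0 \<or> g mod 4 = 3 \<longleftrightarrow> \<not> (g mod 4 = 1 \<or> g mod 4 = 2)" by presburger
  ultimately show ?thesis using assms(2) by (cases "even ((g - 1) div 2)") auto
qed

theorem theorem4p1:
  fixes n :: nat and E :: "nat \<Rightarrow> nat \<Rightarrow> bool" and sg :: "nat \<Rightarrow> nat \<Rightarrow> real"
  assumes "signed_graph n E sg"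
    and "connected_graph n E"
    and "has_cycle n E"
  shows "int (i_plus n E sg) \<ge> \<lceil>real (girth n E) / 2\<rceil> - 1 \<and>
         (int (i_plus n E sg) = \<lceil>real (girth n E) / 2\<rceil> - 1 \<longleftrightarrow>
         ((\<exists>cs. graph_is_cycle n E cs \<and> length cs = girth n E \<and>
              ((balanced_cycle sg cs \<and> (girth n E mod 4 = 0 \<or> girth n E mod 4 = 3)) \<or>
               (\<not> balanced_cycle sg cs \<and> (girth n E mod 4 = 1 \<or> girth n E mod 4 = 2))))
          \<or> switching_equiv_complete_multipartite n E sg))"
proof -
  note sg = assms(1) and conn = assms(2)
  define k where "k = (girth n E - 1) div 2"
  obtain cs where cs: "is_cycle n E cs" "length cs = girth n E"
    using girth_cycle_exists[OF assms(3)] by blast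
  have g: "3 \<le> girth n E" using cs by (auto simp: is_cycle_def)
  have ceil: "\<lceil>real (girth n E) / 2\<rceil> - 1 = int k"
    using ceiling_half_minus_one[of "girth n E"] g by (simp add: k_def)
  have lower: "k \<le> i_plus n E sg"
    using i_plus_girth_lower_bound[OF sg assms(3)] by (simp add: k_def)
  have k1: "1 \<le> k" using g by (auto simp: k_def)
  have residue: "(balanced_cycle sg ds \<and> (girth n E mod 4 = 0 \<or> girth n E mod 4 = 3)) \<or>
      (\<not> balanced_cycle sg ds \<and> (girth n E mod 4 = 1 \<or> girth n E mod 4 = 2))
      \<longleftrightarrow> cycle_sign sg ds = - ((-1) ^ k)" if "graph_is_cycle n E ds" for ds
    unfolding balanced_cycle_def k_def
    using that g by (intro balance_residue_iff cycle_sign_cases[OF sg]) (auto simp: graph_is_cycle_def)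
  have "i_plus n E sg = k \<longleftrightarrow>
      (\<exists>ds. graph_is_cycle n E ds \<and> length ds = girth n E \<and> cycle_sign sg ds = - ((-1) ^ k))
      \<or> switching_equiv_complete_multipartite n E sg"
  proof
    assume eq: "i_plus n E sg = k"
    show "(\<exists>ds. graph_is_cycle n E ds \<and> length ds = girth n E \<and> cycle_sign sg ds = - ((-1) ^ k))
      \<or> switching_equiv_complete_multipartite n E sg"
    proof (cases "girth n E \<le> 4")
      case True
      then have "i_plus n E sg \<le> 1" using eq by (auto simp: k_def)
      moreover have "E (cs ! 0) (cs ! Suc 0)" using is_cycle_edge[OF cs(1), of 0] cs g by simp
      ultimately show ?thesis using i_plus_le_1_imp_complete_multipartite[OF sg conn] by blast
    next
      case False
      then have "set cs = {0..<n}"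
        using i_plus_shortest_cycle_not_spanning[OF sg conn cs] eq by (auto simp: k_def)
      then have gc: "graph_is_cycle n E cs" by (rule spanning_shortest_cycle_is_graph[OF sg cs])
      have "cycle_sign sg cs \<noteq> (-1) ^ k"
        using cycle_graph_i_plus_gt[OF sg gc] eq cs(2) by (auto simp: k_def)
      then have "cycle_sign sg cs = - ((-1) ^ k)"
        using cycle_sign_cases[OF sg cs(1)] by (cases "even k") auto
      then show ?thesis using gc cs by blast
    qed
  next
    assume "(\<exists>ds. graph_is_cycle n E ds \<and> length ds = girth n E \<and> cycle_sign sg ds = - ((-1) ^ k))
      \<or> switching_equiv_complete_multipartite n E sg"
    then have "i_plus n E sg \<le> k"
    proof (elim disjE exE conjE)
      fix ds assume "graph_is_cycle n E ds" "length ds = girth n E" "cycle_sign sg ds = - ((-1) ^ k)"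
      then show ?thesis using cycle_graph_i_plus_le[OF sg, of ds] by (simp add: k_def)
    next
      assume "switching_equiv_complete_multipartite n E sg"
      \<comment> \<open>The girth need not be computed: \<open>k\<close> is at least 1, so the bound
        by 1 suffices.\<close>
      then show ?thesis using complete_multipartite_i_plus_le_1[OF sg] k1 by linarith
    qed
    then show "i_plus n E sg = k" using lower by simp
  qed
  moreover have "(\<exists>cs. graph_is_cycle n E cs \<and> length cs = girth n E \<and>
      ((balanced_cycle sg cs \<and> (girth n E mod 4 = 0 \<or> girth n E mod 4 = 3)) \<or>
       (\<not> balanced_cycle sg cs \<and> (girth n E mod 4 = 1 \<or> girth n E mod 4 = 2)))) \<longleftrightarrow>
      (\<exists>ds. graph_is_cycle n E ds \<and> length ds = girth n E \<and> cycle_sign sg ds = - ((-1) ^ k))"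
    by (intro iff_exI conj_cong refl residue)
  ultimately show ?thesis unfolding ceil of_nat_le_iff of_nat_eq_iff using lower by (simp only: simp_thms)
qed

end
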